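(* Let $D\ge 1$ and $N>2D$ be integers, let $q$ be a prime power, let $\Gamma=J_q(N,D)$ be the Grassmann graph, let $x$ be a vertex of $\Gamma$, and let $\mathcal{N}=\mathcal{N}(x)$ be the nucleus of $\Gamma$ with respect to $x$. Then $$\dim\mathcal{N}=\sum_{i=0}^{D}\binom{D}{i}_q .$$
   Context: Let $\mathbb{F}_q$ be a finite field with $q$ elements and $\mathcal{V}$ an $N$-dimensional vector space over $\mathbb{F}_q$. The Grassmann graph $\Gamma=J_q(N,D)$ has vertex set $X$ consisting of the $D$-dimensional subspaces of $\mathcal{V}$; $y,z\in X$ are adjacent iff $\dim(y\cap z)=D-1$. Let $\partial$ be the path-length distance; for $N>2D$ the diameter is $D$ and $\partial(y,z)=D-\dim(y\cap z)$. For integers $\ell$ put $[\ell]=\frac{q^\ell-1}{q-1}$; $\binom{\ell}{n}_q=\frac{[\ell][\ell-1]\cdots[\ell-n+1]}{[n][n-1]\cdots[1]}$ for $0\le n\le \ell$, and $\binom{\ell}{n}_q=0$ if $\ell<n$ or $n<0$. Let $A\in\mathrm{Mat}_X(\mathbb{C})$ be the adjacency matrix of $\Gamma$ and $V=\mathbb{C}^X$ the standard module (column vectors). $A$ has exactly $D+1$ distinct eigenvalues $\theta_0>\theta_1>\cdots>\theta_D$, namely $\theta_i=q[D][N-D]-[i][N-i+1]$; let $E_i$ be the orthogonal projection of $V$ onto the $\theta_i$-eigenspace of $A$. For $0\le i\le D$ let $E_i^*=E_i^*(x)$ be the diagonal matrix with $(y,y)$-entry $1$ if $\partial(x,y)=i$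 and $0$ otherwise. The Terwilliger algebra $T=T(x)$ is the subalgebra of $\mathrm{Mat}_X(\mathbb{C})$ generated by $A$ and $E_0^*,\dots,E_D^*$. A $T$-module is a subspace $W\subseteq V$ with $TW\subseteq W$; it is irreducible if it is nonzero and has no $T$-submodule other than $0$ and $W$. For an irreducible $T$-module $W$: the endpoint is $r=\min\{i: E_i^*W\ne0\}$, the dual endpoint is $t=\min\{i: E_iW\neq 0\}$, the diameter is $d=|\{i: E_i^*W\ne 0\}|-1$, and the displacement is $r+t-D+d$. The nucleus $\mathcal{N}=\mathcal{N}(x)$ is the span of all irreducible $T$-modules with displacement $0$. *)

theory Defs
  imports "HOL-Analysis.Analysis"
begin

definition qint :: "real \<Rightarrow> nat \<Rightarrow> real" where
  "qint q l = (q ^ l - 1) / (q - 1)"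

definition qbinom :: "real \<Rightarrow> nat \<Rightarrow> nat \<Rightarrow> real" where
  "qbinom q l n =
     (if l < n then 0 else (\<Prod>j<n. qint q (l - j)) / (\<Prod>j<n. qint q (n - j)))"

definition hermitian_inner :: "complex ^ 'x \<Rightarrow> complex ^ 'x \<Rightarrow> complex" where
  "hermitian_inner u v = (\<Sum>y\<in>UNIV. u $ y * cnj (v $ y))"

definition orthogonal_proj :: "(complex ^ 'x) set \<Rightarrow> complex ^ 'x \<Rightarrow> complex ^ 'x" where
  "orthogonal_proj U v =
     (THE u. u \<in> U \<and> (\<forall>w\<in>U. hermitian_inner (v - u) w = 0))"

text \<open>
  A vertex is a set of vectors, so vectors and matrices are indexed by the finite type
  \<^typ>\<open>'v set\<close>. With \<open>X\<close> the set of vertices, \<open>\<complex>\<^sup>X\<close> is the space of vectors vanishing outside \<open>X\<close>,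
  and \<open>Mat\<^sub>X(\<complex>)\<close> is the algebra of matrices vanishing outside \<open>X \<times> X\<close>; its identity is the
  diagonal matrix with ones exactly at the positions in \<open>X\<close>.
\<close>

context
  fixes scale :: "'a::{field,finite} \<Rightarrow> 'v::{ab_group_add,finite} \<Rightarrow> 'v"
    and D :: nat
begin

definition grassmann_vertices :: "'v set set" where
  "grassmann_vertices = {y. module.subspace scale y \<and> vector_space.dim scale y = D}"

definition grassmann_edges :: "('v set \<times> 'v set) set" where
  "grassmann_edges =
     {(y, z). y \<in> grassmann_vertices \<and> z \<in> grassmann_vertices \<and>
              vector_space.dim scale (y \<inter> z) = D - 1}"

definition path_distance :: "'v set \<Rightarrow> 'v set \<Rightarrow> nat" where
  "path_distance y z = (LEAST n. (y, z) \<in> grassmann_edges ^^ n)"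

definition standard_module :: "(complex ^ 'v set) set" where
  "standard_module = {v. \<forall>y. y \<notin> grassmann_vertices \<longrightarrow> v $ y = 0}"

definition adjacency_matrix :: "complex ^ 'v set ^ 'v set" where
  "adjacency_matrix = (\<chi> y z. if (y, z) \<in> grassmann_edges then 1 else 0)"

definition theta :: "nat \<Rightarrow> real" where
  "theta i =
     (let q = real CARD('a); N = vector_space.dim scale (UNIV :: 'v set)
      in q * qint q D * qint q (N - D) - qint q i * qint q (N - i + 1))"

definition theta_eigenspace :: "nat \<Rightarrow> (complex ^ 'v set) set" where
  "theta_eigenspace i =
     {v \<in> standard_module. adjacency_matrix *v v = complex_of_real (theta i) *s v}"

definition primitive_idem :: "nat \<Rightarrow> complex ^ 'v set \<Rightarrow> complex ^ 'v set" where
  "primitive_idem i = orthogonal_proj (theta_eigenspace i)"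

definition dual_idem :: "'v set \<Rightarrow> nat \<Rightarrow> complex ^ 'v set ^ 'v set" where
  "dual_idem x i =
     (\<chi> y z. if y = z \<and> y \<in> grassmann_vertices \<and> path_distance x y = i then 1 else 0)"

inductive_set terwilliger_algebra :: "'v set \<Rightarrow> (complex ^ 'v set ^ 'v set) set"
  for x :: "'v set" where
  identity: "(\<chi> y z. if y = z \<and> y \<in> grassmann_vertices then 1 else 0) \<in> terwilliger_algebra x"
| adjacency: "adjacency_matrix \<in> terwilliger_algebra x"
| dual: "i \<le> D \<Longrightarrow> dual_idem x i \<in> terwilliger_algebra x"
| add: "B \<in> terwilliger_algebra x \<Longrightarrow> C \<in> terwilliger_algebra x \<Longrightarrow>
    B + C \<in> terwilliger_algebra x"
| scalar: "B \<in> terwilliger_algebra x \<Longrightarrow> (\<chi> y z. c * B $ y $ z) \<in> terwilliger_algebra x"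
| mult: "B \<in> terwilliger_algebra x \<Longrightarrow> C \<in> terwilliger_algebra x \<Longrightarrow>
    B ** C \<in> terwilliger_algebra x"

definition T_module :: "'v set \<Rightarrow> (complex ^ 'v set) set \<Rightarrow> bool" where
  "T_module x W \<longleftrightarrow> vec.subspace W \<and> W \<subseteq> standard_module \<and>
     (\<forall>B\<in>terwilliger_algebra x. \<forall>w\<in>W. B *v w \<in> W)"

definition irreducible_T_module :: "'v set \<Rightarrow> (complex ^ 'v set) set \<Rightarrow> bool" where
  "irreducible_T_module x W \<longleftrightarrow> T_module x W \<and> W \<noteq> {0} \<and>
     (\<forall>U. T_module x U \<and> U \<subseteq> W \<longrightarrow> U = {0} \<or> U = W)"

definition support :: "'v set \<Rightarrow> (complex ^ 'v set) set \<Rightarrow> nat set" where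
  "support x W = {i. i \<le> D \<and> (\<exists>w\<in>W. dual_idem x i *v w \<noteq> 0)}"

definition dual_support :: "(complex ^ 'v set) set \<Rightarrow> nat set" where
  "dual_support W = {i. i \<le> D \<and> (\<exists>w\<in>W. primitive_idem i w \<noteq> 0)}"

definition endpoint :: "'v set \<Rightarrow> (complex ^ 'v set) set \<Rightarrow> nat" where
  "endpoint x W = Min (support x W)"

definition dual_endpoint :: "(complex ^ 'v set) set \<Rightarrow> nat" where
  "dual_endpoint W = Min (dual_support W)"

definition module_diameter :: "'v set \<Rightarrow> (complex ^ 'v set) set \<Rightarrow> int" where
  "module_diameter x W = int (card (support x W)) - 1"

definition displacement :: "'v set \<Rightarrow> (complex ^ 'v set) set \<Rightarrow> int" where
  "displacement x W =
     int (endpoint x W) + int (dual_endpoint W) - int D + module_diameter x W"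

definition nucleus :: "'v set \<Rightarrow> (complex ^ 'v set) set" where
  "nucleus x = vec.span (\<Union> {W. irreducible_T_module x W \<and> displacement x W = 0})"

end

end

theory Submission
  imports Defs
begin

text \<open>
  Let \<open>\<eta>\<^sub>a\<close> be the characteristic vector of the vertices containing \<open>a\<close>. The sum of the first \<open>t + 1\<close>
  eigenspaces of the adjacency matrix is the space of functions of degree at most \<open>t\<close>, spanned by
  the \<open>\<eta>\<^sub>a\<close> with \<open>dim a \<le> t\<close>. The nucleus is the \<open>T\<close>-module \<open>M\<close> of functions of \<open>y\<close> that
  depend only on \<open>y \<inter> x\<close>, whose dimension is the number of subspaces of \<open>x\<close>.

  An irreducible \<open>T\<close>-module \<open>W\<close> is supported on distances forming an interval, so its displacement is
  \<open>t - m\<close>, where \<open>t\<close> is the dual endpoint and \<open>m\<close> is the least value of \<open>dim (y \<inter> x)\<close> on the support of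
  \<open>W\<close>. Two facts on a function \<open>f\<close> of degree at most \<open>t\<close> are needed. If \<open>f\<close> vanishes where
  \<open>dim (y \<inter> x) \<le> t\<close>, then \<open>f = 0\<close>; if \<open>f\<close> vanishes where \<open>dim (y \<inter> x) < t\<close>, then \<open>f \<in> M\<close>. Both follow by
  restricting \<open>f\<close> to a suitable interval of the subspace lattice on which it is supported on the covers
  of a single subspace, and \<open>N > 2 D\<close> makes the interval long enough for a norm estimate to force \<open>f\<close> to
  be constant there. Applied to a \<open>\<theta>\<^sub>t\<close>-eigenvector in \<open>W\<close>, they show that \<open>W\<close> has displacement \<open>0\<close> if
  and only if \<open>W \<subseteq> M\<close>.
\<close>

section \<open>Gaussian binomials and subspace lattices over a finite field\<close>

text \<open>The norm estimate concerns functions on rank t + 1 of an interval [P, H] that are images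
  of functions on rank t under the up operator. For a function of degree at most t to restrict to
  such an image, the vertices must have rank t + 1 over P; this is why P has dimension D - t - 1.
  The top H is a largest subspace among those that do not enlarge a prescribed intersection with x,
  so its dimension is N - D + dim (H \<inter> x). With [n] for \<open>qint q n\<close>, the estimate
  compares [t + 1], the number of hyperplanes of a vertex over P, with the gap between the up and
  down operators, and wins as soon as dim H - dim P \<ge> 2 t + 2. When dim (H \<inter> x) = t, that
  difference is N - 2 D + 2 t + 1, so N > 2 D is exactly what the estimate requires.\<close>

lemma qint_0 [simp]: "qint q 0 = 0"
  by (simp add: qint_def)

lemma qint_Suc: "q \<noteq> 1 \<Longrightarrow> qint q (Suc n) = qint q n + q ^ n"
  by (simp add: qint_def field_simps)

lemma qint_add: "q \<noteq> 1 \<Longrightarrow> qint q (m + n) = qint q m + q ^ m * qint q n"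
  by (simp add: qint_def power_add flip: add_divide_distrib) (simp add: algebra_simps)

lemma qint_pos: "q > 1 \<Longrightarrow> n > 0 \<Longrightarrow> qint q n > 0"
  by (simp add: qint_def)

lemma qint_mono: "q > 1 \<Longrightarrow> m \<le> n \<Longrightarrow> qint q m \<le> qint q n"
  by (auto simp: qint_def intro!: divide_right_mono)

lemma qint_one [simp]: "q \<noteq> 1 \<Longrightarrow> qint q (Suc 0) = 1"
  by (simp add: qint_def)

lemma qint_less_power: "q \<ge> 2 \<Longrightarrow> qint q n < q ^ n"
proof -
  assume q: "q \<ge> 2"
  have "q ^ n - 1 < q ^ n * 1" by simp
  also have "\<dots> \<le> q ^ n * (q - 1)" using q by (intro mult_left_mono) auto
  finally show ?thesis using q by (simp add: qint_def pos_divide_less_eq)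
qed

lemma qbinom_0 [simp]: "qbinom q n 0 = 1"
  by (simp add: qbinom_def)

text \<open>The absorption identity, multiplied out. It is the recursion that double counting
  produces in \<open>card_between\<close>.\<close>

lemma qbinom_Suc_Suc:
  assumes "q > 1"
  shows "qbinom q (Suc n) (Suc k) * qint q (Suc k) = qint q (Suc n) * qbinom q n k"
proof (cases "n < k")
  case True
  then show ?thesis by (simp add: qbinom_def)
next
  case False
  have "qint q (Suc k) \<noteq> 0" using qint_pos[OF assms, of "Suc k"] by simp
  then show ?thesis using False
    by (simp add: qbinom_def prod.lessThan_Suc_shift del: prod.lessThan_Suc)
qed

lemma qbinom_corank_one:
  assumes "q > 1"
  shows "qbinom q (Suc n) n = qint q (Suc n)"
proof (induction n)
  case 0
  then show ?case using assms by simp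
next
  case (Suc n)
  have "qint q (Suc n) \<noteq> 0" using qint_pos[OF assms, of "Suc n"] by simp
  then show ?case using qbinom_Suc_Suc[OF assms, of "Suc n" n] Suc by (simp add: mult.commute)
qed

locale finite_vector_space = vector_space scale
  for scale :: "'a::{field,finite} \<Rightarrow> 'v::{ab_group_add,finite} \<Rightarrow> 'v" +
  fixes q :: real
  assumes q_eq: "q = real CARD('a)"
begin

text \<open>The space is a finite type, so every basis is finite; extending the empty set merely
  picks one.\<close>

sublocale finite_dimensional_vector_space scale "extend_basis {}"
  by unfold_locales
    (use independent_extend_basis[of "{}"] span_extend_basis[of "{}"] in \<open>auto simp: independent_empty\<close>)

declare dim_UNIV [simp del]

lemma q_ge_2: "q \<ge> 2"
proof -
  have "card {0::'a, 1} \<le> CARD('a)" by (intro card_mono) auto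
  then show ?thesis by (simp add: q_eq)
qed

lemma q_gt_1: "q > 1" and q_ne_1: "q \<noteq> 1"
  using q_ge_2 by auto

section \<open>Cardinalities, the modular law and complements of subspaces\<close>

abbreviation join :: "'v set \<Rightarrow> 'v set \<Rightarrow> 'v set" where
  "join a b \<equiv> span (a \<union> b)"

lemma span_subspace_eq: "subspace a \<Longrightarrow> span a = a"
  by (simp add: span_eq_iff)

lemma join_ge: "a \<subseteq> join a b" "b \<subseteq> join a b"
  using span_superset by blast+

lemma join_least: "a \<subseteq> c \<Longrightarrow> b \<subseteq> c \<Longrightarrow> subspace c \<Longrightarrow> join a b \<subseteq> c"
  by (simp add: span_minimal)

lemma in_join:
  assumes "subspace a" "subspace b"
  shows "v \<in> join a b \<longleftrightarrow> (\<exists>x\<in>a. \<exists>y\<in>b. v = x + y)"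
  using assms by (auto simp: span_Un span_subspace_eq)

lemma subspace_eqI:
  assumes "subspace a" "subspace b" "a \<subseteq> b" "dim b \<le> dim a"
  shows "a = b"
  using subspace_dim_equal assms by blast

lemma card_span_independent:
  assumes "independent B"
  shows "card (span B) = CARD('a) ^ card B"
proof -
  have "finite B" by simp
  then show ?thesis using assms
  proof (induction B rule: finite_induct)
    case empty
    then show ?case by simp
  next
    case (insert b B)
    have ind: "independent B" and b: "b \<notin> span B"
      using insert.prems insert.hyps(2) by (auto simp: independent_insert)
    have "bij_betw (\<lambda>(c, y). scale c b + y) ((UNIV :: 'a set) \<times> span B) (span (insert b B))"
    proof (rule bij_betwI')
      fix s t assume "s \<in> (UNIV :: 'a set) \<times> span B" "t \<in> (UNIV :: 'a set) \<times> span B"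
      then obtain c y c' y' where st: "s = (c, y)" "t = (c', y')" "y \<in> span B" "y' \<in> span B"
        by auto
      have "c = c'" if "scale c b + y = scale c' b + y'"
      proof (rule ccontr)
        assume c: "c \<noteq> c'"
        have "scale (c - c') b = y' - y"
          using that by (simp add: scale_left_diff_distrib algebra_simps)
        then have "scale (c - c') b \<in> span B" using st span_diff by metis
        then have "scale (inverse (c - c')) (scale (c - c') b) \<in> span B" by (rule span_scale)
        then show False using b c by simp
      qed
      then show "((case s of (c, y) \<Rightarrow> scale c b + y) = (case t of (c, y) \<Rightarrow> scale c b + y))
          = (s = t)" using st by auto
    next
      fix s assume "s \<in> (UNIV :: 'a set) \<times> span B"
      then show "(case s of (c, y) \<Rightarrow> scale c b + y) \<in> span (insert b B)"
        using span_mono[of B "insert b B"]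
        by (auto intro!: span_add span_scale simp: span_base)
    next
      fix v assume "v \<in> span (insert b B)"
      then obtain k where "v - scale k b \<in> span B" by (auto simp: span_insert)
      then show "\<exists>s\<in>(UNIV :: 'a set) \<times> span B. v = (case s of (c, y) \<Rightarrow> scale c b + y)"
        by (intro bexI[of _ "(k, v - scale k b)"]) auto
    qed
    then have "card (span (insert b B)) = CARD('a) * card (span B)"
      by (metis bij_betw_same_card card_cartesian_product)
    then show ?case using insert ind by simp
  qed
qed

lemma card_subspace:
  assumes "subspace a"
  shows "card a = CARD('a) ^ dim a"
proof -
  obtain B where B: "B \<subseteq> a" "independent B" "a \<subseteq> span B"
    using maximal_independent_subset by blast
  then have "span B = a" using assms by (simp add: span_minimal subset_antisym)
  then show ?thesis using card_span_independent[OF B(2)] basis_card_eq_dim B by metis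
qed

text \<open>Counting proof: addition maps \<open>a \<times> b\<close> onto the join, and the fibre
  over s + t consists of the pairs (s + w, t - w) with w in \<open>a \<inter> b\<close>. All fibres
  thus have the same size, and comparing exponents of \<open>CARD('a)\<close> gives the modular
  law.\<close>

lemma dim_join:
  assumes a: "subspace a" and b: "subspace b"
  shows "dim (join a b) + dim (a \<inter> b) = dim a + dim b"
proof -
  let ?fib = "\<lambda>z. {p \<in> a \<times> b. fst p + snd p = z}"
  have i: "subspace (a \<inter> b)" using a b by (rule subspace_inter)
  have fib: "card (?fib z) = card (a \<inter> b)" if z: "z \<in> join a b" for z
  proof -
    obtain s t where st: "s \<in> a" "t \<in> b" "z = s + t" using z in_join[OF a b] by blast
    have "bij_betw (\<lambda>w. (s + w, t - w)) (a \<inter> b) (?fib z)"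
    proof (rule bij_betwI')
      fix w assume "w \<in> a \<inter> b"
      then show "(s + w, t - w) \<in> ?fib z"
        using st subspace_add[OF a] subspace_diff[OF b] by simp
    next
      fix p assume p: "p \<in> ?fib z"
      then have eq: "t - snd p = fst p - s" using st by (auto simp: algebra_simps)
      have "fst p - s \<in> a" "t - snd p \<in> b" using p st a b by (auto intro: subspace_diff)
      then have "fst p - s \<in> a \<inter> b" by (simp add: eq)
      moreover have "t - (fst p - s) = snd p" unfolding eq[symmetric] by simp
      then have "p = (s + (fst p - s), t - (fst p - s))" by (simp add: prod_eq_iff)
      ultimately show "\<exists>w\<in>a \<inter> b. p = (s + w, t - w)" by (rule bexI[rotated])
    qed auto
    then show ?thesis by (rule bij_betw_same_card[symmetric])
  qed
  have "card (a \<times> b) = (\<Sum>z\<in>join a b. card (?fib z))"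
  proof -
    have "fst p + snd p \<in> join a b" if "p \<in> a \<times> b" for p
      using in_join[OF a b] that mem_Times_iff by blast
    then have "a \<times> b = (\<Union>z\<in>join a b. ?fib z)" by blast
    then show ?thesis by (subst card_UN_disjoint[symmetric]) auto
  qed
  then have "card a * card b = card (join a b) * card (a \<inter> b)"
    using fib by (simp add: card_cartesian_product)
  then have "CARD('a) ^ (dim a + dim b) = CARD('a) ^ (dim (join a b) + dim (a \<inter> b))"
    using card_subspace a b i by (simp add: power_add)
  then show ?thesis using q_gt_1 by (simp add: q_eq power_inject_exp)
qed

lemma dim_span_insert:
  assumes "subspace a" "v \<notin> a"
  shows "dim (span (insert v a)) = Suc (dim a)"
  using assms by (simp add: dim_insert span_subspace_eq)

lemma span_insert_eq_cover:
  assumes "subspace a" "subspace b" "a \<subseteq> b" "dim b = Suc (dim a)" "v \<in> b" "v \<notin> a"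
  shows "span (insert v a) = b"
proof (rule subspace_eqI)
  show "span (insert v a) \<subseteq> b" using assms by (intro span_minimal) auto
  show "dim b \<le> dim (span (insert v a))" using assms dim_span_insert by simp
qed (use assms in auto)

lemma exists_between:
  assumes "subspace a" "subspace b" "a \<subseteq> b" "dim a \<le> k" "k \<le> dim b"
  shows "\<exists>c. subspace c \<and> a \<subseteq> c \<and> c \<subseteq> b \<and> dim c = k"
  using assms(4,5)
proof (induction k rule: dec_induct)
  case base
  then show ?case using assms by blast
next
  case (step k)
  then obtain c where c: "subspace c" "a \<subseteq> c" "c \<subseteq> b" "dim c = k" by auto
  then obtain v where v: "v \<in> b" "v \<notin> c" using step.prems by (metis Suc_n_not_le_n subsetI subset_antisym)
  have "span (insert v c) \<subseteq> b" using c v assms by (intro span_minimal) auto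
  moreover have "a \<subseteq> span (insert v c)" using c span_superset by blast
  ultimately show ?case using dim_span_insert[OF c(1) v(2)] c by (intro exI[of _ "span (insert v c)"]) auto
qed

text \<open>Extend a basis of \<open>e\<close> to one of \<open>y\<close> and take the span of the
  new vectors. The dimension equation encodes the trivial intersection.\<close>

lemma exists_complement:
  assumes y: "subspace y" and e: "subspace e" and "e \<subseteq> y"
  shows "\<exists>P. subspace P \<and> P \<subseteq> y \<and> join P e = y \<and> dim P + dim e = dim y"
proof -
  obtain B where B: "B \<subseteq> e" "independent B" "e \<subseteq> span B" using maximal_independent_subset by blast
  obtain C where C: "B \<subseteq> C" "C \<subseteq> y" "independent C" "y \<subseteq> span C"
    using maximal_independent_subset_extend[of B y] B assms by (metis subset_trans)
  have ind: "independent (C - B)" using C(3) by (rule independent_mono) auto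
  have "card B = dim e" "card C = dim y" using B C basis_card_eq_dim by auto
  moreover have "dim (span (C - B)) = card (C - B)" using ind by (simp add: dim_eq_card_independent)
  moreover have "card (C - B) + card B = card C"
    using C(1) by (metis card_Diff_subset card_mono finite le_add_diff_inverse2)
  moreover have "join (span (C - B)) e = y"
  proof
    show "join (span (C - B)) e \<subseteq> y" using C y assms by (intro join_least span_minimal) auto
    have "C \<subseteq> span (C - B) \<union> e" using B span_superset by blast
    then show "y \<subseteq> join (span (C - B)) e" using C(4) span_mono by blast
  qed
  moreover have "span (C - B) \<subseteq> y" using C y by (intro span_minimal) auto
  ultimately show ?thesis by (intro exI[of _ "span (C - B)"]) auto
qed

text \<open>Adjoin to \<open>y\<close> a complement of y + x in the whole space. The modular law
  makes this dimension the largest possible for a subspace with that intersection; it supplies the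
  length of the intervals used later.\<close>

lemma exists_transversal_extension:
  assumes y: "subspace y" and x: "subspace x"
  shows "\<exists>H. subspace H \<and> y \<subseteq> H \<and> H \<inter> x = y \<inter> x \<and> dim H + dim x = dim (UNIV :: 'v set) + dim (y \<inter> x)"
proof -
  obtain P where P: "subspace P" "join P (join y x) = UNIV"
      "dim P + dim (join y x) = dim (UNIV :: 'v set)"
    using exists_complement[of UNIV "join y x"] by auto
  let ?H = "join y P"
  have d: "dim (join y x) + dim (y \<inter> x) = dim y + dim x" using dim_join y x by blast
  have "join y x \<inter> P = {0}"
  proof -
    have "dim (join y x \<inter> P) = 0"
      using dim_join[of P "join y x"] P by (simp add: Int_commute)
    then show ?thesis using subspace_0[of P] P by (auto simp: span_zero)
  qed
  then have "y \<inter> P \<subseteq> {0}" using join_ge(1)[of y x] by auto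
  then have "dim (y \<inter> P) = 0" by simp
  then have dH: "dim ?H = dim y + dim P" using dim_join[of y P] y P by linarith
  have "join ?H x = UNIV"
  proof -
    have "P \<subseteq> join ?H x" "y \<subseteq> join ?H x" "x \<subseteq> join ?H x"
      using join_ge by (meson order_trans)+
    then have "join P (join y x) \<subseteq> join ?H x" by (intro join_least) auto
    then show ?thesis using P by auto
  qed
  then have "dim (?H \<inter> x) = dim (y \<inter> x)"
    using dim_join[of ?H x] x dH P d by auto
  moreover have "y \<inter> x \<subseteq> ?H \<inter> x" using join_ge by blast
  ultimately have "?H \<inter> x = y \<inter> x"
    using subspace_eqI[of "y \<inter> x" "?H \<inter> x"] x y by (auto simp: subspace_inter)
  moreover have "dim ?H + dim x = dim (UNIV :: 'v set) + dim (y \<inter> x)"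
    using dH d P by auto
  ultimately show ?thesis using join_ge by (intro exI[of _ ?H]) auto
qed

section \<open>Counting the subspaces in an interval\<close>

definition between :: "'v set \<Rightarrow> 'v set \<Rightarrow> nat \<Rightarrow> 'v set set" where
  "between P H k = {b. subspace b \<and> P \<subseteq> b \<and> b \<subseteq> H \<and> dim b = k}"

text \<open>A vector of \<open>H\<close> outside \<open>P\<close> lies in exactly one cover of
  \<open>P\<close>, so the covers partition \<open>H - P\<close> into blocks of equal size.\<close>

lemma card_between_Suc:
  assumes P: "subspace P" and H: "subspace H" and "P \<subseteq> H"
  shows "real (card (between P H (Suc (dim P)))) = qint q (dim H - dim P)"
proof -
  let ?c = "between P H (Suc (dim P))"
  have le: "dim P \<le> dim H" using dim_subset assms by blast
  have "H - P = (\<Union>b\<in>?c. b - P)"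
  proof
    show "H - P \<subseteq> (\<Union>b\<in>?c. b - P)"
    proof
      fix v assume v: "v \<in> H - P"
      have "P \<subseteq> span (insert v P)" using span_superset by blast
      moreover have "span (insert v P) \<subseteq> H" using v assms by (intro span_minimal) auto
      ultimately have "span (insert v P) \<in> ?c"
        using v dim_span_insert[OF P, of v] by (simp add: between_def)
      then show "v \<in> (\<Union>b\<in>?c. b - P)" using v span_base[of v "insert v P"] by blast
    qed
  qed (auto simp: between_def)
  moreover have "card (\<Union>b\<in>?c. b - P) = (\<Sum>b\<in>?c. card (b - P))"
  proof (rule card_UN_disjoint)
    show "\<forall>i\<in>?c. \<forall>j\<in>?c. i \<noteq> j \<longrightarrow> (i - P) \<inter> (j - P) = {}"
    proof (intro ballI impI)
      fix i j assume ij: "i \<in> ?c" "j \<in> ?c" "i \<noteq> j"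
      have "i = j" if "v \<in> (i - P) \<inter> (j - P)" for v
        using span_insert_eq_cover[OF P, of i v] span_insert_eq_cover[OF P, of j v] ij that
        by (simp add: between_def)
      then show "(i - P) \<inter> (j - P) = {}" using ij by blast
    qed
  qed auto
  ultimately have "card (H - P) = (\<Sum>b\<in>?c. card (b - P))" by simp
  also have "\<dots> = (\<Sum>b\<in>?c. CARD('a) ^ Suc (dim P) - CARD('a) ^ dim P)"
    using P by (intro sum.cong) (auto simp: between_def card_Diff_subset card_subspace)
  finally have "CARD('a) ^ dim H - CARD('a) ^ dim P
      = card ?c * (CARD('a) ^ Suc (dim P) - CARD('a) ^ dim P)"
    using assms by (simp add: card_Diff_subset card_subspace)
  then have "real (CARD('a) ^ dim H - CARD('a) ^ dim P)
      = real (card ?c * (CARD('a) ^ Suc (dim P) - CARD('a) ^ dim P))" by presburger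
  then have "q ^ dim H - q ^ dim P = real (card ?c) * (q ^ Suc (dim P) - q ^ dim P)"
    using le q_gt_1 by (simp add: q_eq of_nat_diff power_increasing)
  moreover have "q ^ dim H = q ^ dim P * q ^ (dim H - dim P)"
    using le by (simp flip: power_add)
  ultimately have "q ^ dim P * (q ^ (dim H - dim P) - 1) = q ^ dim P * (real (card ?c) * (q - 1))"
    by (simp add: algebra_simps)
  then have "q ^ (dim H - dim P) - 1 = real (card ?c) * (q - 1)"
    using q_gt_1 by (subst (asm) mult_cancel_left) auto
  then show ?thesis using q_gt_1 by (simp add: qint_def)
qed

text \<open>Double count the pairs of a cover p of \<open>P\<close> and a subspace b of the wanted
  dimension above p.\<close>

lemma card_between:
  assumes "subspace P" "subspace H" "P \<subseteq> H"
  shows "real (card (between P H (dim P + k))) = qbinom q (dim H - dim P) k"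
  using assms
proof (induction k arbitrary: P)
  case 0
  have "between P H (dim P) = {P}"
  proof -
    have "b = P" if "b \<in> between P H (dim P)" for b
      using that 0 by (intro subspace_eqI[symmetric]) (auto simp: between_def)
    then show ?thesis using 0 by (auto simp: between_def)
  qed
  then show ?case by simp
next
  case (Suc k)
  let ?p = "between P H (Suc (dim P))" and ?b = "between P H (dim P + Suc k)"
  have "(\<Sum>b\<in>?b. real (card (between P b (Suc (dim P)))))
      = (\<Sum>p\<in>?p. real (card (between p H (dim P + Suc k))))"
  proof -
    have "card {b \<in> ?b. p \<subseteq> b} = card (between p H (dim P + Suc k))" if "p \<in> ?p" for p
      using that by (intro arg_cong[where f = card]) (auto simp: between_def)
    moreover have "card {p \<in> ?p. p \<subseteq> b} = card (between P b (Suc (dim P)))" if "b \<in> ?b" for b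
      using that by (intro arg_cong[where f = card]) (auto simp: between_def)
    moreover have "(\<Sum>p\<in>?p. card {b \<in> ?b. p \<subseteq> b}) = (\<Sum>b\<in>?b. card {p \<in> ?p. p \<subseteq> b})"
      by (rule sum_multicount_gen) auto
    ultimately show ?thesis by (simp flip: of_nat_sum)
  qed
  moreover have "real (card (between P b (Suc (dim P)))) = qint q (Suc k)" if "b \<in> ?b" for b
    using that card_between_Suc[of P b] Suc.prems by (auto simp: between_def)
  moreover have "real (card (between p H (dim P + Suc k))) = qbinom q (dim H - Suc (dim P)) k"
    if "p \<in> ?p" for p
    using that Suc.IH[of p] Suc.prems by (auto simp: between_def)
  ultimately have e: "real (card ?b) * qint q (Suc k)
      = qint q (dim H - dim P) * qbinom q (dim H - Suc (dim P)) k"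
    using card_between_Suc[OF Suc.prems] by simp
  have nz: "qint q (Suc k) \<noteq> 0" using qint_pos[OF q_gt_1, of "Suc k"] by simp
  show ?case
  proof (cases "dim H - dim P")
    case 0
    then have "real (card ?b) = 0" using e nz by simp
    then show ?thesis using 0 by (simp add: qbinom_def)
  next
    case (Suc n)
    then have "dim H - Suc (dim P) = n" by simp
    then show ?thesis using e nz qbinom_Suc_Suc[OF q_gt_1, of n k] Suc
      by (metis mult_right_cancel)
  qed
qed

text \<open>Writing the rank as \<open>Suc (dim b) = dim H\<close> avoids truncated subtraction: for
  \<open>H = P\<close> the set is empty, in accordance with [0] = 0.\<close>

lemma card_between_hyperplanes:
  assumes "subspace P" "subspace H" "P \<subseteq> H"
  shows "real (card {b. subspace b \<and> P \<subseteq> b \<and> b \<subseteq> H \<and> Suc (dim b) = dim H}) = qint q (dim H - dim P)"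
proof (cases "dim H - dim P")
  case 0
  have False if "P \<subseteq> b" "Suc (dim b) = dim H" for b
    using dim_subset[OF that(1)] that(2) 0 by linarith
  then have "{b. subspace b \<and> P \<subseteq> b \<and> b \<subseteq> H \<and> Suc (dim b) = dim H} = {}"
    by blast
  then show ?thesis using 0 by simp
next
  case (Suc n)
  then have "{b. subspace b \<and> P \<subseteq> b \<and> b \<subseteq> H \<and> Suc (dim b) = dim H} = between P H (dim P + n)"
    by (auto simp: between_def)
  then show ?thesis using card_between[OF assms, of n] Suc qbinom_corank_one[OF q_gt_1] by simp
qed

end

section \<open>Functions supported on a star\<close>

lemma sum_of_bool_card: "finite Y \<Longrightarrow> (\<Sum>y\<in>Y. of_bool (R y)) = real (card {y \<in> Y. R y})"
  by (simp add: Int_def)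

text \<open>The squared norm of the image of \<open>c\<close> under an incidence matrix is a
  quadratic form whose Gram matrix counts common neighbours.\<close>

lemma sum_square_incidence:
  fixes c :: "'b \<Rightarrow> real"
  assumes "finite Y" "finite B"
  shows "(\<Sum>y\<in>Y. (\<Sum>b\<in>B. of_bool (R b y) * c b)\<^sup>2)
    = (\<Sum>b\<in>B. \<Sum>b'\<in>B. real (card {y \<in> Y. R b y \<and> R b' y}) * (c b * c b'))"
proof -
  have "(\<Sum>y\<in>Y. (\<Sum>b\<in>B. of_bool (R b y) * c b)\<^sup>2)
      = (\<Sum>y\<in>Y. \<Sum>b\<in>B. \<Sum>b'\<in>B. of_bool (R b y \<and> R b' y) * (c b * c b'))"
    by (intro sum.cong refl) (simp add: power2_eq_square sum_product of_bool_conj mult_ac)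
  also have "\<dots> = (\<Sum>b\<in>B. \<Sum>y\<in>Y. \<Sum>b'\<in>B. of_bool (R b y \<and> R b' y) * (c b * c b'))"
    by (rule sum.swap)
  also have "\<dots> = (\<Sum>b\<in>B. \<Sum>b'\<in>B. \<Sum>y\<in>Y. of_bool (R b y \<and> R b' y) * (c b * c b'))"
    by (intro sum.cong refl) (rule sum.swap)
  also have "\<dots> = (\<Sum>b\<in>B. \<Sum>b'\<in>B. real (card {y \<in> Y. R b y \<and> R b' y}) * (c b * c b'))"
  proof (intro sum.cong refl)
    fix b b'
    have "(\<Sum>y\<in>Y. of_bool (R b y \<and> R b' y)) = real (card {y \<in> Y. R b y \<and> R b' y})"
      using assms by (simp only: sum_of_bool_card)
    then show "(\<Sum>y\<in>Y. of_bool (R b y \<and> R b' y) * (c b * c b'))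
        = real (card {y \<in> Y. R b y \<and> R b' y}) * (c b * c b')"
      by (simp flip: sum_distrib_right)
  qed
  finally show ?thesis .
qed

context finite_vector_space
begin

lemma join_le_iff: "subspace c \<Longrightarrow> join a b \<subseteq> c \<longleftrightarrow> a \<subseteq> c \<and> b \<subseteq> c"
  using join_ge join_least by (meson order_trans)

section \<open>Up and down operators on an interval\<close>

lemma dim_le_cover:
  assumes "subspace b" "subspace b'" "b \<noteq> b'" "dim b = dim b'"
  shows "Suc (dim b) \<le> dim (join b b')"
proof (rule ccontr)
  assume "\<not> Suc (dim b) \<le> dim (join b b')"
  then have le: "dim (join b b') \<le> dim b" by simp
  have "b = join b b'" using assms le join_ge by (intro subspace_eqI) auto
  moreover have "b' = join b b'" using assms le join_ge by (intro subspace_eqI) auto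
  ultimately show False using assms by simp
qed

lemma card_common_covers:
  assumes H: "subspace H" and b: "b \<in> between P H k" and b': "b' \<in> between P H k"
  shows "real (card {y \<in> between P H (Suc k). b \<subseteq> y \<and> b' \<subseteq> y})
    = (if b = b' then qint q (dim H - k) else of_bool (dim (join b b') = Suc k))"
proof (cases "b = b'")
  case True
  have "{y \<in> between P H (Suc k). b \<subseteq> y \<and> b' \<subseteq> y} = between b H (Suc (dim b))"
    using b True by (auto simp: between_def)
  then show ?thesis using card_between_Suc[of b H] assms True by (simp add: between_def)
next
  case False
  have sub: "subspace b" "subspace b'" "dim b = k" "dim b' = k" "b \<subseteq> H" "b' \<subseteq> H" "P \<subseteq> b"
    using b b' by (auto simp: between_def)
  have ge: "Suc k \<le> dim (join b b')" using dim_le_cover[of b b'] sub False by simp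
  have eq: "y = join b b' \<and> dim (join b b') = Suc k"
    if "y \<in> between P H (Suc k)" "b \<subseteq> y" "b' \<subseteq> y" for y
  proof -
    have "join b b' \<subseteq> y" using that join_least by (auto simp: between_def)
    moreover from this have "dim (join b b') \<le> Suc k" using that dim_subset[of "join b b'" y] by (simp add: between_def)
    ultimately show ?thesis using that ge subspace_eqI[of "join b b'" y] unfolding between_def
      by (metis (mono_tags, lifting) le_antisym mem_Collect_eq subspace_span)
  qed
  show ?thesis
  proof (cases "dim (join b b') = Suc k")
    case True
    have "join b b' \<in> between P H (Suc k)"
      using True sub order_trans[OF \<open>P \<subseteq> b\<close> join_ge(1)] join_least[OF \<open>b \<subseteq> H\<close> \<open>b' \<subseteq> H\<close> H]
      by (simp add: between_def)
    then have "{y \<in> between P H (Suc k). b \<subseteq> y \<and> b' \<subseteq> y} = {join b b'}"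
    proof (intro equalityI subsetI)
      fix y assume "y \<in> {y \<in> between P H (Suc k). b \<subseteq> y \<and> b' \<subseteq> y}"
      then have "y = join b b'" using eq by simp
      then show "y \<in> {join b b'}" by simp
    qed (use join_ge[of _ b] join_ge[of _ b'] in simp)
    then show ?thesis using True False by simp
  next
    case F: False
    then have empty: "{y \<in> between P H (Suc k). b \<subseteq> y \<and> b' \<subseteq> y} = {}" using eq by blast
    show ?thesis unfolding empty using F False by simp
  qed
qed

text \<open>For distinct b and b' the only candidate is the intersection. By the modular law it has
  dimension k - 1 exactly when the join has dimension k + 1, so the count can be phrased through the
  join and compared with \<open>card_common_covers\<close>.\<close>

lemma card_common_cocovers:
  assumes P: "subspace P" and b: "b \<in> between P H k" and b': "b' \<in> between P H k"
  shows "real (card {d. (subspace d \<and> P \<subseteq> d \<and> Suc (dim d) = k) \<and> d \<subseteq> b \<and> d \<subseteq> b'})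
    = (if b = b' then qint q (k - dim P) else of_bool (dim (join b b') = Suc k))"
proof (cases "b = b'")
  case True
  have "{d. (subspace d \<and> P \<subseteq> d \<and> Suc (dim d) = k) \<and> d \<subseteq> b \<and> d \<subseteq> b'}
      = {d. subspace d \<and> P \<subseteq> d \<and> d \<subseteq> b \<and> Suc (dim d) = dim b}"
    using b True by (auto simp: between_def)
  then show ?thesis using card_between_hyperplanes[of P b] assms True by (auto simp: between_def)
next
  case False
  let ?S = "{d. (subspace d \<and> P \<subseteq> d \<and> Suc (dim d) = k) \<and> d \<subseteq> b \<and> d \<subseteq> b'}"
  have sub: "subspace b" "subspace b'" "dim b = k" "dim b' = k" "P \<subseteq> b" "P \<subseteq> b'"
    using b b' by (auto simp: between_def)
  have sum: "dim (join b b') + dim (b \<inter> b') = 2 * k" using dim_join sub by auto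
  have ge: "Suc k \<le> dim (join b b')" using dim_le_cover[of b b'] sub False by simp
  have eq: "d = b \<inter> b' \<and> dim (join b b') = Suc k" if "d \<in> ?S" for d
  proof -
    have "d \<subseteq> b \<inter> b'" using that by blast
    moreover from this have "dim d \<le> dim (b \<inter> b')" by (rule dim_subset)
    ultimately show ?thesis using that ge sum sub subspace_inter[of b b'] subspace_eqI[of d "b \<inter> b'"]
      by auto
  qed
  show ?thesis
  proof (cases "dim (join b b') = Suc k")
    case True
    have "b \<inter> b' \<in> ?S" using True sum sub subspace_inter[of b b'] ge by auto
    then have "?S = {b \<inter> b'}" using eq by blast
    then show ?thesis using True False by simp
  next
    case F: False
    then have empty: "?S = {}" using eq by blast
    show ?thesis unfolding empty using F False by simp
  qed
qed

text \<open>Common covers and common cocovers of two distinct elements agree in number, so the Gram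
  matrices of the up and down operators differ by a multiple of the identity.\<close>

lemma up_norm_ge:
  fixes c :: "'v set \<Rightarrow> real" and k :: nat
  assumes P: "subspace P" and H: "subspace H"
  defines "B \<equiv> between P H k"
  shows "(qint q (dim H - k) - qint q (k - dim P)) * (\<Sum>b\<in>B. (c b)\<^sup>2)
    \<le> (\<Sum>y\<in>between P H (Suc k). (\<Sum>b\<in>B. of_bool (b \<subseteq> y) * c b)\<^sup>2)"
proof -
  \<comment> \<open>With \<open>Suc (dim d) = k\<close> instead of rank k - 1, the case k = 0 gives
    the empty set and the zero down operator.\<close>
  let ?S = "{d. subspace d \<and> P \<subseteq> d \<and> Suc (dim d) = k}"
  let ?u = "\<lambda>b b'. real (card {y \<in> between P H (Suc k). b \<subseteq> y \<and> b' \<subseteq> y})"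
  let ?d = "\<lambda>b b'. real (card {d \<in> ?S. d \<subseteq> b \<and> d \<subseteq> b'})"
  have diff: "?u b b' - ?d b b' = (if b = b' then qint q (dim H - k) - qint q (k - dim P) else 0)"
    if "b \<in> B" "b' \<in> B" for b b'
    using that card_common_covers[OF H] card_common_cocovers[OF P] unfolding B_def by simp
  have "(\<Sum>y\<in>between P H (Suc k). (\<Sum>b\<in>B. of_bool (b \<subseteq> y) * c b)\<^sup>2)
      - (\<Sum>d\<in>?S. (\<Sum>b\<in>B. of_bool (d \<subseteq> b) * c b)\<^sup>2)
      = (\<Sum>b\<in>B. \<Sum>b'\<in>B. ?u b b' * (c b * c b')) - (\<Sum>b\<in>B. \<Sum>b'\<in>B. ?d b b' * (c b * c b'))"
    by (subst (1 2) sum_square_incidence) auto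
  also have "\<dots> = (\<Sum>b\<in>B. \<Sum>b'\<in>B. (?u b b' - ?d b b') * (c b * c b'))"
    by (simp add: sum_subtractf left_diff_distrib)
  also have "\<dots> = (\<Sum>b\<in>B. \<Sum>b'\<in>B.
      if b = b' then (qint q (dim H - k) - qint q (k - dim P)) * (c b * c b') else 0)"
    by (intro sum.cong refl) (subst diff, auto)
  also have "\<dots> = (qint q (dim H - k) - qint q (k - dim P)) * (\<Sum>b\<in>B. (c b)\<^sup>2)"
    by (simp add: sum_distrib_left power2_eq_square)
  \<comment> \<open>The squared norm of the down operator is nonnegative and is dropped.\<close>
  finally show ?thesis
    using sum_nonneg[of ?S "\<lambda>d. (\<Sum>b\<in>B. of_bool (d \<subseteq> b) * c b)\<^sup>2"] by simp
qed

text \<open>A function on a star with zero sum has a small image under the down operator, which contradicts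
  the lower bound for the up operator.\<close>

lemma zero_sum_on_star:
  fixes c :: "'v set \<Rightarrow> real"
  assumes P: "subspace P" and H: "subspace H" and "P \<subseteq> H"
    and k: "k = dim P + t" and dH: "dim P + 2 * t + 2 \<le> dim H"
    and h: "h \<in> between P H k"
    and g: "\<And>y. y \<in> between P H (Suc k) \<Longrightarrow> g y = (\<Sum>b\<in>between P H k. of_bool (b \<subseteq> y) * c b)"
    and supp: "\<And>y. y \<in> between P H (Suc k) \<Longrightarrow> \<not> h \<subseteq> y \<Longrightarrow> g y = 0"
    and sum0: "(\<Sum>y\<in>between P H (Suc k). of_bool (h \<subseteq> y) * g y) = 0"
    and y: "y \<in> between P H (Suc k)"
  shows "g y = 0"
proof -
  let ?B = "between P H k" and ?Y = "between P H (Suc k)"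
  let ?D = "\<lambda>b. \<Sum>y\<in>?Y. of_bool (b \<subseteq> y) * g y"
  define G where "G = (\<Sum>y\<in>?Y. (g y)\<^sup>2)"
  define C where "C = (\<Sum>b\<in>?B. (c b)\<^sup>2)"
  define \<kappa> where "\<kappa> = qint q (dim H - k) - qint q (k - dim P)"
  have G0: "G \<ge> 0" unfolding G_def by (simp add: sum_nonneg)
  have "\<kappa> * C \<le> G"
    using up_norm_ge[OF P H, where k = k and c = c] g unfolding G_def C_def \<kappa>_def by simp
  \<comment> \<open>A \<open>b\<close> other than \<open>h\<close> has at most one common cover with
    \<open>h\<close>, so \<open>?D b\<close> has at most one nonzero term. For \<open>b = h\<close>
    it is the sum assumed to vanish.\<close>
  have D: "(?D b)\<^sup>2 \<le> (\<Sum>y\<in>?Y. of_bool (b \<subseteq> y) * (g y)\<^sup>2)" if b: "b \<in> ?B" for b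
  proof (cases "b = h")
    case True
    then show ?thesis using sum0 by (simp add: sum_nonneg)
  next
    case False
    let ?S = "{y \<in> ?Y. b \<subseteq> y \<and> h \<subseteq> y}"
    have "real (card ?S) \<le> 1" using card_common_covers[OF H b h] False by simp
    moreover have "?D b = sum g ?S"
      using supp by (intro sum.mono_neutral_cong_right) auto
    moreover have "(\<Sum>y\<in>?Y. of_bool (b \<subseteq> y) * (g y)\<^sup>2) = (\<Sum>y\<in>?S. (g y)\<^sup>2)"
      using supp by (intro sum.mono_neutral_cong_right) auto
    moreover have "(sum g ?S)\<^sup>2 \<le> (\<Sum>y\<in>?S. (g y)\<^sup>2) * real (card ?S)"
      by (rule sum_squared_le_sum_of_squares)
    moreover have "(\<Sum>y\<in>?S. (g y)\<^sup>2) * real (card ?S) \<le> (\<Sum>y\<in>?S. (g y)\<^sup>2) * 1"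
      using calculation by (intro mult_left_mono) (auto intro: sum_nonneg)
    ultimately show ?thesis by simp
  qed
  have "(\<Sum>b\<in>?B. (?D b)\<^sup>2) \<le> (\<Sum>b\<in>?B. \<Sum>y\<in>?Y. of_bool (b \<subseteq> y) * (g y)\<^sup>2)"
    using D by (rule sum_mono)
  also have "\<dots> = (\<Sum>y\<in>?Y. (\<Sum>b\<in>?B. of_bool (b \<subseteq> y)) * (g y)\<^sup>2)"
    by (subst sum.swap) (simp add: sum_distrib_right)
  also have "\<dots> = (\<Sum>y\<in>?Y. qint q (Suc t) * (g y)\<^sup>2)"
  proof (intro sum.cong refl arg_cong2[where f = "(*)"])
    fix y assume y: "y \<in> ?Y"
    have "(\<Sum>b\<in>?B. of_bool (b \<subseteq> y)) = real (card {b \<in> ?B. b \<subseteq> y})"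
      by (simp only: sum_of_bool_card finite)
    also have "{b \<in> ?B. b \<subseteq> y} = {b. subspace b \<and> P \<subseteq> b \<and> b \<subseteq> y \<and> Suc (dim b) = dim y}"
      using y by (auto simp: between_def)
    also have "real (card \<dots>) = qint q (Suc t)"
      using y P k by (subst card_between_hyperplanes) (auto simp: between_def)
    finally show "(\<Sum>b\<in>?B. of_bool (b \<subseteq> y)) = qint q (Suc t)" .
  qed
  finally have DG: "(\<Sum>b\<in>?B. (?D b)\<^sup>2) \<le> qint q (Suc t) * G"
    unfolding G_def by (simp add: sum_distrib_left)
  \<comment> \<open>Up and down operators are adjoint: the squared norm of g is the inner product of
    \<open>c\<close> with the down image of g, and Cauchy-Schwarz applies.\<close>
  have "G = (\<Sum>y\<in>?Y. \<Sum>b\<in>?B. c b * (of_bool (b \<subseteq> y) * g y))"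
    unfolding G_def
  proof (intro sum.cong refl)
    fix y assume "y \<in> ?Y"
    then have "g y * g y = (\<Sum>b\<in>?B. of_bool (b \<subseteq> y) * c b) * g y" by (simp only: g)
    then show "(g y)\<^sup>2 = (\<Sum>b\<in>?B. c b * (of_bool (b \<subseteq> y) * g y))"
      by (simp only: power2_eq_square sum_distrib_left mult_ac)
  qed
  also have "\<dots> = (\<Sum>b\<in>?B. c b * ?D b)"
    by (subst sum.swap) (simp only: sum_distrib_left)
  finally have "G\<^sup>2 \<le> C * (\<Sum>b\<in>?B. (?D b)\<^sup>2)"
    unfolding C_def by (simp add: Cauchy_Schwarz_ineq_sum)
  moreover have "C \<ge> 0" unfolding C_def by (simp add: sum_nonneg)
  ultimately have GC: "G\<^sup>2 \<le> C * (qint q (Suc t) * G)"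
    using DG by (meson mult_left_mono order_trans)
  \<comment> \<open>The interval length gives dim H - k \<ge> t + 2, and [t + 2] - [t] = q^t +
    q^(t+1) exceeds [t + 1] = [t] + q^t because [t] < q^t. One dimension less would leave only q^t,
    which is at most [t + 1].\<close>
  have \<kappa>: "\<kappa> > qint q (Suc t)"
  proof -
    have "qint q (Suc (Suc t)) \<le> qint q (dim H - k)" using dH k q_gt_1 by (intro qint_mono) auto
    moreover have "qint q t < q ^ t" using q_ge_2 by (rule qint_less_power)
    moreover have "q ^ t \<le> q ^ Suc t" using q_gt_1 by (intro power_increasing) auto
    ultimately show ?thesis unfolding \<kappa>_def using k q_ne_1 by (simp add: qint_Suc)
  qed
  have "G = 0"
  proof (rule ccontr)
    assume "G \<noteq> 0"
    then have "G > 0" using G0 by simp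
    moreover have pos: "qint q (Suc t) > 0" using q_gt_1 by (simp add: qint_pos)
    ultimately have "G \<le> C * qint q (Suc t)" using GC by (simp add: power2_eq_square mult_ac)
    then have "C > 0" using \<open>G > 0\<close> pos by (metis less_le_trans zero_less_mult_pos2)
    then have "C * qint q (Suc t) < C * \<kappa>" using \<kappa> mult_strict_left_mono by blast
    then show False using \<open>G \<le> C * qint q (Suc t)\<close> \<open>\<kappa> * C \<le> G\<close> by (simp add: mult.commute)
  qed
  then show ?thesis using y unfolding G_def by (simp add: sum_nonneg_eq_0_iff)
qed

text \<open>Subtract from f its mean \<open>\<mu>\<close> on the star of \<open>h\<close>. The
  indicator of the star is the up image of the unit function at \<open>h\<close>, so only the
  coefficient of \<open>h\<close> changes, and the remainder has zero sum.\<close>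

lemma constant_on_star:
  fixes c :: "'v set \<Rightarrow> real"
  assumes P: "subspace P" and H: "subspace H" and PH: "P \<subseteq> H"
    and k: "k = dim P + t" and dH: "dim P + 2 * t + 2 \<le> dim H"
    and h: "h \<in> between P H k"
    and f: "\<And>y. y \<in> between P H (Suc k) \<Longrightarrow> f y = (\<Sum>b\<in>between P H k. of_bool (b \<subseteq> y) * c b)"
    and supp: "\<And>y. y \<in> between P H (Suc k) \<Longrightarrow> \<not> h \<subseteq> y \<Longrightarrow> f y = 0"
    and y: "y \<in> between P H (Suc k)" "h \<subseteq> y" and y': "y' \<in> between P H (Suc k)" "h \<subseteq> y'"
  shows "f y = f y'"
proof -
  let ?B = "between P H k" and ?Y = "between P H (Suc k)"
  define \<mu> where "\<mu> = (\<Sum>y\<in>?Y. of_bool (h \<subseteq> y) * f y) / (\<Sum>y\<in>?Y. of_bool (h \<subseteq> y))"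
  define g where "g = (\<lambda>y. f y - \<mu> * of_bool (h \<subseteq> y))"
  have "g z = 0" if z: "z \<in> ?Y" for z
  proof (rule zero_sum_on_star[OF P H PH k dH h _ _ _ z, where c = "c(h := c h - \<mu>)"])
    fix z assume z: "z \<in> ?Y"
    have "(\<Sum>b\<in>?B. of_bool (b \<subseteq> z) * (c(h := c h - \<mu>)) b)
        = (\<Sum>b\<in>?B. of_bool (b \<subseteq> z) * c b - (if b = h then \<mu> * of_bool (h \<subseteq> z) else 0))"
      by (intro sum.cong refl) (auto simp: algebra_simps)
    then show "g z = (\<Sum>b\<in>?B. of_bool (b \<subseteq> z) * (c(h := c h - \<mu>)) b)"
      using f[OF z] h by (simp add: g_def sum_subtractf)
    show "\<not> h \<subseteq> z \<Longrightarrow> g z = 0" using supp[OF z] by (simp add: g_def)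
  next
    have "(\<Sum>y\<in>?Y. of_bool (h \<subseteq> y) :: real) > 0"
      using y by (intro sum_pos2[of _ y]) auto
    moreover have "(\<Sum>y\<in>?Y. of_bool (h \<subseteq> y) * g y)
        = (\<Sum>y\<in>?Y. of_bool (h \<subseteq> y) * f y) - \<mu> * (\<Sum>y\<in>?Y. of_bool (h \<subseteq> y))"
      unfolding g_def sum_distrib_left sum_subtractf[symmetric]
      by (intro sum.cong refl) (auto simp: algebra_simps)
    ultimately show "(\<Sum>y\<in>?Y. of_bool (h \<subseteq> y) * g y) = 0" by (simp add: \<mu>_def)
  qed
  from this[OF y(1)] this[OF y'(1)] show ?thesis using y y' by (simp add: g_def)
qed

text \<open>Only the values on D-dimensional subspaces matter. Real values suffice, since complex
  vectors are treated through their real and imaginary parts.\<close>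

definition low_degree :: "nat \<Rightarrow> nat \<Rightarrow> ('v set \<Rightarrow> real) \<Rightarrow> bool" where
  "low_degree D t f \<longleftrightarrow> (\<exists>c. \<forall>y. subspace y \<and> dim y = D \<longrightarrow>
     f y = (\<Sum>a | subspace a \<and> dim a \<le> t. of_bool (a \<subseteq> y) * c a))"

text \<open>For \<open>y\<close> above \<open>P\<close>, the indicator of \<open>a \<subseteq> y\<close> is an average over the hyperplanes of \<open>y\<close> that
  contain \<open>P\<close> and \<open>a\<close>.\<close>

lemma low_degree_interval:
  assumes f: "low_degree (Suc (dim P + t)) t f" and P: "subspace P"
  shows "\<exists>c. \<forall>y\<in>between P H (Suc (dim P + t)).
    f y = (\<Sum>b\<in>between P H (dim P + t). of_bool (b \<subseteq> y) * c b)"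
proof -
  let ?D = "Suc (dim P + t)" and ?B = "between P H (dim P + t)"
  let ?A = "{a. subspace a \<and> dim a \<le> t}"
  obtain c where c: "\<And>y. subspace y \<and> dim y = ?D \<Longrightarrow> f y = (\<Sum>a\<in>?A. of_bool (a \<subseteq> y) * c a)"
    using f unfolding low_degree_def by blast
  \<comment> \<open>The number of hyperplanes of \<open>y\<close> containing \<open>P\<close> and
    \<open>a\<close>, when \<open>a \<subseteq> y\<close>. It does not depend on \<open>y\<close>,
    so dividing by it yields admissible coefficients; it is positive because \<open>join P a\<close>
    has dimension below \<open>?D\<close>.\<close>
  let ?n = "\<lambda>a. qint q (?D - dim (join P a))"
  have "f y = (\<Sum>b\<in>?B. of_bool (b \<subseteq> y) * (\<Sum>a\<in>?A. of_bool (a \<subseteq> b) * (c a / ?n a)))"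
    if y: "y \<in> between P H ?D" for y
  proof -
    have ys: "subspace y" "dim y = ?D" "P \<subseteq> y" "y \<subseteq> H" using y by (auto simp: between_def)
    have "(\<Sum>b\<in>?B. of_bool (b \<subseteq> y \<and> a \<subseteq> b)) = of_bool (a \<subseteq> y) * ?n a" if a: "a \<in> ?A" for a
    proof -
      have "(\<Sum>b\<in>?B. of_bool (b \<subseteq> y \<and> a \<subseteq> b)) = real (card {b \<in> ?B. b \<subseteq> y \<and> a \<subseteq> b})"
        by (simp only: sum_of_bool_card finite)
      also have "\<dots> = of_bool (a \<subseteq> y) * ?n a"
      proof (cases "a \<subseteq> y")
        case True
        have "{b \<in> ?B. b \<subseteq> y \<and> a \<subseteq> b}
            = {b. subspace b \<and> join P a \<subseteq> b \<and> b \<subseteq> y \<and> Suc (dim b) = dim y}"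
          using ys by (intro set_eqI) (simp add: between_def join_le_iff cong: conj_cong, blast)
        then show ?thesis
          using True ys join_least[of P y a] card_between_hyperplanes[of "join P a" y] by simp
      next
        case False
        then have empty: "{b \<in> ?B. b \<subseteq> y \<and> a \<subseteq> b} = {}" by blast
        show ?thesis unfolding empty using False by simp
      qed
      finally show ?thesis .
    qed
    moreover have "?n a \<noteq> 0" if a: "a \<in> ?A" for a
    proof -
      have "dim (join P a) \<le> dim P + t" using dim_join[OF P, of a] a by simp
      then have "?n a > 0" using q_gt_1 by (intro qint_pos) auto
      then show ?thesis by simp
    qed
    ultimately have e: "of_bool (a \<subseteq> y) * c a = (\<Sum>b\<in>?B. of_bool (b \<subseteq> y \<and> a \<subseteq> b)) * (c a / ?n a)"
      if "a \<in> ?A" for a using that by simp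
    have "f y = (\<Sum>a\<in>?A. (\<Sum>b\<in>?B. of_bool (b \<subseteq> y \<and> a \<subseteq> b)) * (c a / ?n a))"
      using c[of y] ys e by simp
    also have "\<dots> = (\<Sum>a\<in>?A. \<Sum>b\<in>?B. of_bool (b \<subseteq> y) * (of_bool (a \<subseteq> b) * (c a / ?n a)))"
      by (simp only: sum_distrib_right of_bool_conj mult.assoc)
    also have "\<dots> = (\<Sum>b\<in>?B. of_bool (b \<subseteq> y) * (\<Sum>a\<in>?A. of_bool (a \<subseteq> b) * (c a / ?n a)))"
      by (subst sum.swap) (simp only: sum_distrib_left)
    finally show ?thesis .
  qed
  then show ?thesis by (intro exI ballI)
qed

lemma low_degree_constant_on_star:
  assumes f: "low_degree D t f" and P: "subspace P" and H: "subspace H"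
    and D: "D = Suc (dim P + t)" and dH: "dim P + 2 * t + 2 \<le> dim H"
    and h: "subspace h" "P \<subseteq> h" "dim h = dim P + t"
    and supp: "\<And>y. subspace y \<Longrightarrow> dim y = D \<Longrightarrow> P \<subseteq> y \<Longrightarrow> y \<subseteq> H \<Longrightarrow> f y \<noteq> 0 \<Longrightarrow> h \<subseteq> y"
    and y: "subspace y" "dim y = D" "h \<subseteq> y" "y \<subseteq> H"
    and y': "subspace y'" "dim y' = D" "h \<subseteq> y'" "y' \<subseteq> H"
  shows "f y = f y'"
proof -
  obtain c where c: "\<And>y. y \<in> between P H (Suc (dim P + t)) \<Longrightarrow>
      f y = (\<Sum>b\<in>between P H (dim P + t). of_bool (b \<subseteq> y) * c b)"
    using low_degree_interval[of P t f H] f P D by blast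
  show ?thesis
  proof (rule constant_on_star[OF P H _ refl dH _ c])
    show "P \<subseteq> H" using h y by blast
    show "h \<in> between P H (dim P + t)" using h y by (auto simp: between_def)
    show "f z = 0" if "z \<in> between P H (Suc (dim P + t))" "\<not> h \<subseteq> z" for z
      using that supp D by (auto simp: between_def)
  qed (use y y' h D in \<open>auto simp: between_def\<close>)
qed

end

section \<open>Functions of low degree\<close>

context finite_vector_space
begin

text \<open>Take the join of \<open>w\<close> with a complement of \<open>span (insert v w)\<close>
  in \<open>y\<close>; if it contained \<open>v\<close>, it would be all of
  \<open>y\<close>.\<close>

lemma exists_hyperplane_avoiding:
  assumes y: "subspace y" and w: "subspace w" and "w \<subseteq> y" and v: "v \<in> y" "v \<notin> w"
  shows "\<exists>h. subspace h \<and> w \<subseteq> h \<and> h \<subseteq> y \<and> v \<notin> h \<and> Suc (dim h) = dim y"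
proof -
  let ?w = "span (insert v w)"
  have w': "?w \<subseteq> y" using assms by (intro span_minimal) auto
  have ww: "w \<subseteq> ?w" using span_superset by blast
  obtain P where P: "subspace P" "P \<subseteq> y" "join P ?w = y" "dim P + dim ?w = dim y"
    using exists_complement[OF y _ w'] by auto
  have "dim (P \<inter> w) \<le> dim (P \<inter> ?w)" using ww by (intro dim_subset) auto
  moreover have "dim (P \<inter> ?w) = 0" using dim_join[OF P(1), of ?w] P by simp
  ultimately have "dim (join P w) = dim P + dim w" using dim_join[OF P(1) w] by linarith
  then have d: "Suc (dim (join P w)) = dim y" using P dim_span_insert[OF w v(2)] by simp
  have sub: "join P w \<subseteq> y" using P assms by (simp add: join_le_iff)
  have "v \<notin> join P w"
  proof
    assume "v \<in> join P w"
    then have "?w \<subseteq> join P w" using join_ge(2)[of w P] by (intro span_minimal) auto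
    then have "y \<subseteq> join P w" using P join_ge(1)[of P w] join_le_iff[of "join P w" P ?w] by auto
    then show False using d sub by (metis n_not_Suc_n subset_antisym)
  qed
  then show ?thesis using d sub join_ge(2)[of w P] by (intro exI[of _ "join P w"]) auto
qed

lemma span_insert_Int_transversal:
  assumes y: "subspace y" and x: "subspace x" and v: "v \<notin> join y x"
  shows "span (insert v y) \<inter> x = y \<inter> x"
proof
  show "span (insert v y) \<inter> x \<subseteq> y \<inter> x"
  proof
    fix w assume w: "w \<in> span (insert v y) \<inter> x"
    then obtain k where "w - scale k v \<in> y" by (auto simp: span_insert span_subspace_eq y)
    moreover have "k = 0"
    proof (rule ccontr)
      assume k: "k \<noteq> 0"
      have "w \<in> join y x" "w - scale k v \<in> join y x"
        using w join_ge(2)[of x y] \<open>w - scale k v \<in> y\<close> join_ge(1)[of y x] by auto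
      then have "w - (w - scale k v) \<in> join y x" by (rule span_diff)
      moreover have "w - (w - scale k v) = scale k v" by simp
      ultimately have "scale k v \<in> join y x" by metis
      then have "scale (inverse k) (scale k v) \<in> join y x" by (rule span_scale)
      then show False using k v by simp
    qed
    ultimately show "w \<in> y \<inter> x" using w by simp
  qed
  show "y \<inter> x \<subseteq> span (insert v y) \<inter> x" using span_superset by blast
qed

text \<open>Take y in the support of f with dim (y \<inter> x) minimal; it is at least t + 1. Let P
  be a complement in y of a (t + 1)-dimensional part e of y \<inter> x, and H a largest extension of
  y with H \<inter> x = y \<inter> x. By minimality a support vertex in [P, H] contains P and e,
  hence equals y. But f is constant on the star of any hyperplane h of y above P, and that star
  contains other vertices of the interval.\<close>

lemma low_degree_vanishing:
  assumes f: "low_degree D t f" and x: "subspace x" "dim x = D"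
    and N: "2 * D < dim (UNIV :: 'v set)"
    and zero: "\<And>y. subspace y \<Longrightarrow> dim y = D \<Longrightarrow> dim (y \<inter> x) \<le> t \<Longrightarrow> f y = 0"
    and y0: "subspace y0" "dim y0 = D"
  shows "f y0 = 0"
proof (rule ccontr)
  assume nz: "f y0 \<noteq> 0"
  define R where "R = (\<lambda>j. \<exists>y. subspace y \<and> dim y = D \<and> f y \<noteq> 0 \<and> dim (y \<inter> x) = j)"
  define j where "j = (LEAST j. R j)"
  have "R j" unfolding j_def by (rule LeastI[of _ "dim (y0 \<inter> x)"]) (use nz y0 in \<open>auto simp: R_def\<close>)
  then obtain y where y: "subspace y" "dim y = D" "f y \<noteq> 0" "dim (y \<inter> x) = j"
    by (auto simp: R_def)
  have least: "j \<le> dim (z \<inter> x)" if "subspace z" "dim z = D" "f z \<noteq> 0" for z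
    unfolding j_def by (rule Least_le) (use that in \<open>auto simp: R_def\<close>)
  have jt: "Suc t \<le> j" using zero y by (metis not_less_eq_eq)
  have yx: "subspace (y \<inter> x)" using y x by (simp add: subspace_inter)
  obtain e where e: "subspace e" "e \<subseteq> y \<inter> x" "dim e = Suc t"
    using exists_between[of "{0}" "y \<inter> x" "Suc t"] yx jt y subspace_0[OF yx] by auto
  obtain P where P: "subspace P" "P \<subseteq> y" "join P e = y" "dim P + dim e = D"
    using exists_complement[of y e] y e by auto
  obtain H where H: "subspace H" "y \<subseteq> H" "H \<inter> x = y \<inter> x" "dim H + D = dim (UNIV :: 'v set) + j"
    using exists_transversal_extension[OF y(1) x(1)] x y by auto
  obtain h where h: "subspace h" "P \<subseteq> h" "h \<subseteq> y" "dim h = dim P + t"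
    using exists_between[of P y "dim P + t"] P y e by auto
  \<comment> \<open>dim H = N - D + j exceeds D, so the star of \<open>h\<close> has room for a
    vertex other than \<open>y\<close>.\<close>
  have "\<not> H \<subseteq> y" using H y N dim_subset[of H y] by linarith
  then obtain v where v: "v \<in> H" "v \<notin> y" by blast
  have uniq: "z = y" if z: "subspace z" "dim z = D" "P \<subseteq> z" "z \<subseteq> H" "f z \<noteq> 0" for z
  proof -
    have "z \<inter> x \<subseteq> y \<inter> x" using z H by blast
    then have "z \<inter> x = y \<inter> x"
      using least[of z] z y x yx by (intro subspace_eqI) (auto simp: subspace_inter)
    then have "e \<subseteq> z" using e by blast
    then have "y \<subseteq> z" using P z join_le_iff[of z P e] by auto
    then show ?thesis using subspace_eqI[of y z] y z by auto
  qed
  define y' where "y' = span (insert v h)"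
  have "v \<notin> h" using v h by blast
  then have dy': "dim y' = D" unfolding y'_def using dim_span_insert[OF h(1)] h P e by simp
  have hy': "h \<subseteq> y'" unfolding y'_def using span_superset by blast
  have y'H: "y' \<subseteq> H" unfolding y'_def using v h H by (intro span_minimal) auto
  have "v \<in> y'" unfolding y'_def by (simp add: span_base)
  have "f y = f y'"
  proof (rule low_degree_constant_on_star[OF f P(1) H(1) _ _ h(1,2,4)])
    show "D = Suc (dim P + t)" using P e by simp
    show "dim P + 2 * t + 2 \<le> dim H" using P e H N jt by linarith
    show "h \<subseteq> z" if "subspace z" "dim z = D" "P \<subseteq> z" "z \<subseteq> H" "f z \<noteq> 0" for z
      using uniq[OF that] h by simp
  qed (use y y'_def dy' hy' y'H h H in auto)
  then have "y' = y" using uniq[of y'] y'_def dy' hy' y'H h y by auto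
  then show False using v \<open>v \<in> y'\<close> by simp
qed

text \<open>In the interval from a complement of \<open>h \<inter> x\<close> in \<open>h\<close> up to a subspace meeting \<open>x\<close> in \<open>h \<inter> x\<close>
  only, every subspace in the support of \<open>f\<close> contains \<open>h\<close>.\<close>

lemma low_degree_adjacent_transversal:
  assumes f: "low_degree D t f" and x: "subspace x" "dim x = D"
    and N: "2 * D < dim (UNIV :: 'v set)"
    and zero: "\<And>y. subspace y \<Longrightarrow> dim y = D \<Longrightarrow> dim (y \<inter> x) < t \<Longrightarrow> f y = 0"
    and h: "subspace h" "Suc (dim h) = D" "dim (h \<inter> x) = t"
    and y: "subspace y" "dim y = D" "h \<subseteq> y"
    and y': "subspace y'" "dim y' = D" "h \<subseteq> y'"
    and join: "join y y' \<inter> x = h \<inter> x"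
  shows "f y = f y'"
proof -
  have u: "subspace (h \<inter> x)" using h x by (simp add: subspace_inter)
  obtain P where P: "subspace P" "P \<subseteq> h" "join P (h \<inter> x) = h" "dim P + t = dim h"
    using exists_complement[of h "h \<inter> x"] h u by auto
  obtain H where H: "subspace H" "join y y' \<subseteq> H" "H \<inter> x = h \<inter> x"
      "dim H + D = dim (UNIV :: 'v set) + t"
    using exists_transversal_extension[of "join y y'" x] x h join by auto
  show ?thesis
  proof (rule low_degree_constant_on_star[OF f P(1) H(1) _ _ h(1) P(2)])
    \<comment> \<open>Here dim P = D - 1 - t and dim H = N - D + t, so equality holds for N = 2 D +
      1.\<close>
    show "dim P + 2 * t + 2 \<le> dim H" using P h H N by linarith
    show "h \<subseteq> z" if z: "subspace z" "dim z = D" "P \<subseteq> z" "z \<subseteq> H" "f z \<noteq> 0" for z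
    proof -
      have "t \<le> dim (z \<inter> x)" using zero[OF z(1,2)] z(5) by (meson not_le)
      then have "z \<inter> x = h \<inter> x"
        using z H x h u by (intro subspace_eqI) (auto simp: subspace_inter)
      then show ?thesis using P z join_le_iff[of z P "h \<inter> x"] by auto
    qed
  qed (use y y' h P H join_ge[of y y'] join_ge[of y' y] in auto)
qed

text \<open>The join of y and y' may meet x in more than h \<inter> x. Then compare both with a
  third vertex z, spanned by h and a vector outside the join of y, y' and x: the joins of z with y
  and with y' meet x only in h \<inter> x.\<close>

lemma low_degree_adjacent:
  assumes f: "low_degree D t f" and x: "subspace x" "dim x = D"
    and N: "2 * D < dim (UNIV :: 'v set)"
    and zero: "\<And>y. subspace y \<Longrightarrow> dim y = D \<Longrightarrow> dim (y \<inter> x) < t \<Longrightarrow> f y = 0"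
    and h: "subspace h" "Suc (dim h) = D" "dim (h \<inter> x) = t"
    and y: "subspace y" "dim y = D" "h \<subseteq> y" "y \<inter> x = h \<inter> x"
    and y': "subspace y'" "dim y' = D" "h \<subseteq> y'" "y' \<inter> x = h \<inter> x"
  shows "f y = f y'"
proof (cases "join y y' \<inter> x = h \<inter> x")
  case True
  then show ?thesis using low_degree_adjacent_transversal[OF f x N zero h y(1-3) y'(1-3)] by blast
next
  case False
  let ?J = "join y y'"
  have "h \<subseteq> y \<inter> y'" using y y' by blast
  then have "dim h \<le> dim (y \<inter> y')" by (rule dim_subset)
  then have dJ: "dim ?J \<le> Suc D" using dim_join[of y y'] y y' h by linarith
  have "h \<inter> x \<subseteq> ?J \<inter> x" using y join_ge(1)[of y y'] by blast
  then have "Suc t \<le> dim (?J \<inter> x)"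
    using False h x subspace_eqI[of "h \<inter> x" "?J \<inter> x"] by (metis not_less_eq_eq subspace_inter subspace_span)
  \<comment> \<open>The dimension is at most (D + 1) + D - (t + 1) = 2 D - t.\<close>
  then have "dim (join ?J x) < dim (UNIV :: 'v set)" using dim_join[of ?J x] dJ x N by simp
  then obtain v where v: "v \<notin> join ?J x" by (metis UNIV_eq_I less_irrefl)
  define z where "z = span (insert v h)"
  have vJ: "v \<notin> ?J" using v join_ge(1)[of ?J x] by blast
  then have "v \<notin> h" using y join_ge(1)[of y y'] by blast
  then have dz: "subspace z" "dim z = D" "h \<subseteq> z"
    unfolding z_def using dim_span_insert[OF h(1)] h span_superset[of "insert v h"] by auto
  have key: "f w = f z" if w: "subspace w" "dim w = D" "h \<subseteq> w" "w \<inter> x = h \<inter> x" "w \<subseteq> ?J" for w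
  proof -
    have "join w x \<subseteq> join ?J x"
      using w(5) join_ge[of ?J x] join_ge[of x ?J] by (intro join_least) (auto simp: Un_commute)
    then have "span (insert v w) \<inter> x = h \<inter> x"
      using span_insert_Int_transversal[of w x v] w x v by auto
    moreover have "join w z = span (insert v w)"
    proof
      show "join w z \<subseteq> span (insert v w)"
        unfolding z_def using w(3) by (intro join_least span_mono) (auto intro: span_base)
      show "span (insert v w) \<subseteq> join w z"
        using join_ge[of w z] join_ge(2)[of z w] by (intro span_minimal) (auto simp: z_def span_base)
    qed
    ultimately show ?thesis
      using low_degree_adjacent_transversal[OF f x N zero h w(1-3) dz] by simp
  qed
  show ?thesis using key[of y] key[of y'] y y' join_ge[of y y'] join_ge[of y' y] by simp
qed

text \<open>Walk from y to y' through adjacent vertices with the same intersection with x,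
  increasing the dimension of the intersection with y' at each step. A step exchanges a vector of y
  for some v in y', and the difficulty is to keep the intersection with x from growing.\<close>

lemma low_degree_same_intersection:
  assumes f: "low_degree D t f" and x: "subspace x" "dim x = D"
    and N: "2 * D < dim (UNIV :: 'v set)"
    and zero: "\<And>y. subspace y \<Longrightarrow> dim y = D \<Longrightarrow> dim (y \<inter> x) < t \<Longrightarrow> f y = 0"
    and y: "subspace y" "dim y = D" "dim (y \<inter> x) = t"
    and y': "subspace y'" "dim y' = D" "y' \<inter> x = y \<inter> x"
  shows "f y = f y'"
  using y y'(3)
proof (induction "D - dim (y \<inter> y')" arbitrary: y rule: less_induct)
  case (less y)
  show ?case
  proof (cases "y = y'")
    case True
    then show ?thesis by simp
  next
    case False
    let ?w = "y \<inter> y'"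
    have w: "subspace ?w" using less.prems y' by (simp add: subspace_inter)
    have u: "y \<inter> x \<subseteq> ?w" using less.prems by blast
    have "\<not> y' \<subseteq> y" using False less.prems y' subspace_eqI[of y' y] by auto
    then obtain v where v: "v \<in> y'" "v \<notin> y" by blast
    have "\<not> y \<subseteq> y'" using False less.prems y' subspace_eqI[of y y'] by auto
    then obtain y1 where y1: "y1 \<in> y" "y1 \<notin> y'" by blast
    \<comment> \<open>If v lies in y + x, then p is its component in \<open>y\<close>, and the
      hyperplane \<open>h\<close> of \<open>y\<close> must avoid p. Otherwise v creates no new
      intersection, and any vector of \<open>y\<close> outside \<open>y'\<close> will do.\<close>
    obtain p where p: "p \<in> y" "p \<notin> ?w" "v \<in> join y x \<longrightarrow> v - p \<in> x"
    proof (cases "v \<in> join y x")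
      case True
      then obtain p s where ps: "p \<in> y" "s \<in> x" "v = p + s" using in_join less.prems x by blast
      have "p \<notin> y'"
      proof
        assume "p \<in> y'"
        then have "v - p \<in> y'" using v y' by (blast intro: subspace_diff)
        then have "s \<in> y \<inter> x" using ps less.prems by auto
        then show False using ps v less.prems(1) subspace_add[of y p s] by auto
      qed
      then show ?thesis using that[of p] ps by auto
    next
      case False
      then show ?thesis using that[of y1] y1 by auto
    qed
    obtain h where h: "subspace h" "?w \<subseteq> h" "h \<subseteq> y" "p \<notin> h" "Suc (dim h) = D"
      using exists_hyperplane_avoiding[OF less.prems(1) w _ p(1,2)] less.prems by auto
    have hx: "h \<inter> x = y \<inter> x" using h u by blast
    \<comment> \<open>If v = h0 + s with h0 in \<open>h\<close> and s in \<open>x\<close>, then p -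
      h0 lies in \<open>y \<inter> x\<close>, which is inside \<open>h\<close>, so \<open>h\<close>
      would contain p.\<close>
    have vh: "v \<notin> join h x"
    proof
      assume a: "v \<in> join h x"
      have "join h x \<subseteq> join y x" using h by (intro span_mono) auto
      then have vp: "v - p \<in> x" using a p by blast
      obtain h0 s where hs: "h0 \<in> h" "s \<in> x" "v = h0 + s" using a in_join h x by blast
      have "p - h0 = s - (v - p)" using hs by (simp add: algebra_simps)
      moreover have "s - (v - p) \<in> x" using hs vp x subspace_diff by blast
      ultimately have "p - h0 \<in> x" by metis
      moreover have "p - h0 \<in> y" using p hs h less.prems by (blast intro: subspace_diff)
      ultimately have "p - h0 \<in> h" using hx by blast
      then have "p - h0 + h0 \<in> h" using hs h by (blast intro: subspace_add)
      then show False using h by simp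
    qed
    define z where "z = span (insert v h)"
    have "v \<notin> h" using v h by blast
    then have z: "subspace z" "dim z = D" "h \<subseteq> z" "v \<in> z"
      unfolding z_def using dim_span_insert[OF h(1)] h span_superset[of "insert v h"] by auto
    have zx: "z \<inter> x = h \<inter> x" unfolding z_def using span_insert_Int_transversal[OF h(1) x(1) vh] .
    have "dim (h \<inter> x) = t" using hx less.prems by simp
    then have "f y = f z"
      using low_degree_adjacent[OF f x N zero h(1,5) _ less.prems(1,2) h(3) hx[symmetric] z(1-3) zx]
      by blast
    also have "f z = f y'"
    proof (rule less.hyps)
      have "span (insert v ?w) \<subseteq> z \<inter> y'"
        using z h v y' by (intro span_minimal) (auto simp: subspace_inter)
      then have "Suc (dim ?w) \<le> dim (z \<inter> y')"
        using dim_span_insert[OF w, of v] v dim_subset[of "span (insert v ?w)" "z \<inter> y'"] by simp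
      moreover have "dim (z \<inter> y') \<le> D" using dim_subset[of "z \<inter> y'" z] z by auto
      ultimately show "D - dim (z \<inter> y') < D - dim ?w" by linarith
    qed (use z zx hx less.prems in auto)
    finally show ?thesis .
  qed
qed

text \<open>On the vertices with dim (y \<inter> x) = t the claim is already known. So f can be
  corrected by indicators of t-dimensional subspaces of x until it vanishes there; the remainder
  still has degree at most t and is zero by \<open>low_degree_vanishing\<close>, and the correction
  depends only on y \<inter> x.\<close>

lemma low_degree_depends_on_intersection:
  assumes f: "low_degree D t f" and x: "subspace x" "dim x = D"
    and N: "2 * D < dim (UNIV :: 'v set)"
    and zero: "\<And>y. subspace y \<Longrightarrow> dim y = D \<Longrightarrow> dim (y \<inter> x) < t \<Longrightarrow> f y = 0"
    and y: "subspace y" "dim y = D" and y': "subspace y'" "dim y' = D" and eq: "y' \<inter> x = y \<inter> x"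
  shows "f y = f y'"
proof -
  let ?C = "\<lambda>u y. subspace y \<and> dim y = D \<and> y \<inter> x = u"
  let ?A = "{a. subspace a \<and> dim a \<le> t}"
  \<comment> \<open>The default 0 restricts the sum over \<open>?A\<close> to t-dimensional
    subspaces of \<open>x\<close>; the choice of the vertex is immaterial by
    \<open>low_degree_same_intersection\<close>.\<close>
  define g where "g = (\<lambda>a. if a \<subseteq> x \<and> dim a = t then f (SOME y. ?C a y) else 0)"
  have g: "g (y \<inter> x) = f y" if "subspace y" "dim y = D" "dim (y \<inter> x) = t" for y
  proof -
    have "?C (y \<inter> x) (SOME z. ?C (y \<inter> x) z)" by (rule someI[of _ y]) (use that in auto)
    then show ?thesis
      using low_degree_same_intersection[OF f x N zero that, of "SOME z. ?C (y \<inter> x) z"] that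
      by (auto simp: g_def)
  qed
  have G: "(\<Sum>a\<in>?A. of_bool (a \<subseteq> z) * g a) = (\<Sum>a\<in>?A. of_bool (a \<subseteq> z \<inter> x) * g a)" for z
    by (intro sum.cong refl) (auto simp: g_def)
  define f' where "f' = (\<lambda>z. f z - (\<Sum>a\<in>?A. of_bool (a \<subseteq> z) * g a))"
  have f': "low_degree D t f'"
  proof -
    obtain c where c: "\<And>y. subspace y \<Longrightarrow> dim y = D \<Longrightarrow> f y = (\<Sum>a\<in>?A. of_bool (a \<subseteq> y) * c a)"
      using f unfolding low_degree_def by blast
    have "f' y = (\<Sum>a\<in>?A. of_bool (a \<subseteq> y) * (c a - g a))" if "subspace y" "dim y = D" for y
      using c[OF that] by (simp only: f'_def right_diff_distrib sum_subtractf)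
    then show ?thesis unfolding low_degree_def by (intro exI allI impI) simp
  qed
  have "f' z = 0" if z: "subspace z" "dim z = D" for z
  proof (rule low_degree_vanishing[OF f' x N _ z])
    fix y assume y: "subspace y" "dim y = D" "dim (y \<inter> x) \<le> t"
    have yx: "subspace (y \<inter> x)" using y x by (simp add: subspace_inter)
    have "(\<Sum>a\<in>?A. of_bool (a \<subseteq> y \<inter> x) * g a)
        = (\<Sum>a\<in>?A. if a = y \<inter> x then g (y \<inter> x) else 0)"
    proof (intro sum.cong refl)
      fix a assume a: "a \<in> ?A"
      show "of_bool (a \<subseteq> y \<inter> x) * g a = (if a = y \<inter> x then g (y \<inter> x) else 0)"
      proof (cases "a \<subseteq> y \<inter> x \<and> dim a = t")
        case True
        then have "a = y \<inter> x" using subspace_eqI[of a "y \<inter> x"] a yx y by auto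
        then show ?thesis by simp
      qed (auto simp: g_def)
    qed
    also have "\<dots> = g (y \<inter> x)" using yx y by simp
    also have "\<dots> = f y"
    proof (cases "dim (y \<inter> x) = t")
      case True
      then show ?thesis using g y by simp
    next
      case False
      then show ?thesis using zero y by (simp add: g_def)
    qed
    finally show "f' y = 0" using G[of y] by (simp add: f'_def)
  qed
  from this[OF y] this[OF y'] show ?thesis using G[of y] G[of y'] eq by (simp add: f'_def)
qed

end

section \<open>The adjacency matrix of the Grassmann graph\<close>

lemma matrix_vector_nth: "(B *v v) $ y = (\<Sum>z\<in>UNIV. B $ y $ z * v $ z)"
  by (simp add: matrix_vector_mult_def)

locale grassmann = finite_vector_space scale q
  for scale :: "'a::{field,finite} \<Rightarrow> 'v::{ab_group_add,finite} \<Rightarrow> 'v" and q :: real +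
  fixes D :: nat and x :: "'v set"
  assumes D_ge_1: "D \<ge> 1"
    and two_D_less: "2 * D < dim (UNIV :: 'v set)"
    and x_vertex: "x \<in> grassmann_vertices scale D"
begin

abbreviation X :: "'v set set" where "X \<equiv> grassmann_vertices scale D"
abbreviation E :: "('v set \<times> 'v set) set" where "E \<equiv> grassmann_edges scale D"
abbreviation A :: "complex ^ 'v set ^ 'v set" where "A \<equiv> adjacency_matrix scale D"
abbreviation V :: "(complex ^ 'v set) set" where "V \<equiv> standard_module scale D"
abbreviation N :: nat where "N \<equiv> dim (UNIV :: 'v set)"
abbreviation \<theta> :: "nat \<Rightarrow> real" where "\<theta> \<equiv> theta scale D"
abbreviation Eig :: "nat \<Rightarrow> (complex ^ 'v set) set" where "Eig \<equiv> theta_eigenspace scale D"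

section \<open>Path length and intersection dimension\<close>

lemma X_iff: "y \<in> X \<longleftrightarrow> subspace y \<and> dim y = D"
  by (simp add: grassmann_vertices_def)

lemma E_iff: "(y, z) \<in> E \<longleftrightarrow> y \<in> X \<and> z \<in> X \<and> dim (y \<inter> z) = D - 1"
  by (simp add: grassmann_edges_def)

lemma E_sym: "(y, z) \<in> E \<longleftrightarrow> (z, y) \<in> E"
  by (auto simp: E_iff Int_commute)

lemma x_subspace: "subspace x" and dim_x: "dim x = D"
  using x_vertex by (auto simp: X_iff)

lemma dim_Int_x_le: "y \<in> X \<Longrightarrow> dim (y \<inter> x) \<le> D"
  using dim_subset[of "y \<inter> x" x] dim_x by simp

text \<open>The hyperplane z \<inter> y of z cuts z \<inter> x down by at most one dimension, and
  what remains lies in y \<inter> x.\<close>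

lemma adjacent_dim_Int:
  assumes "(z, y) \<in> E"
  shows "dim (z \<inter> x) \<le> Suc (dim (y \<inter> x))"
proof -
  have zy: "subspace z" "subspace y" "dim z = D" "dim (z \<inter> y) = D - 1"
    using assms by (auto simp: E_iff X_iff)
  have s: "subspace (z \<inter> x)" "subspace (z \<inter> y)" using zy x_subspace by (simp_all add: subspace_inter)
  have "join (z \<inter> x) (z \<inter> y) \<subseteq> z" using zy by (simp add: join_le_iff)
  then have "dim (join (z \<inter> x) (z \<inter> y)) \<le> D" using dim_subset zy by metis
  moreover have "dim (z \<inter> x \<inter> (z \<inter> y)) \<le> dim (y \<inter> x)" by (intro dim_subset) auto
  ultimately show ?thesis using dim_join[OF s] zy D_ge_1 by linarith
qed

lemma path_dim_Int:
  assumes "(x, y) \<in> E ^^ n"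
  shows "D \<le> dim (y \<inter> x) + n"
  using assms
proof (induction n arbitrary: y)
  case 0
  then show ?case using dim_x by auto
next
  case (Suc n)
  then obtain z where z: "(x, z) \<in> E ^^ n" "(z, y) \<in> E" by auto
  then show ?case using Suc.IH[OF z(1)] adjacent_dim_Int[OF z(2)] by simp
qed

text \<open>Replace y by the span of a hyperplane of y above y \<inter> x and a vector of x outside
  y: this is a neighbour one step closer to x.\<close>

lemma exists_path:
  assumes "y \<in> X"
  shows "(x, y) \<in> E ^^ (D - dim (y \<inter> x))"
  using assms
proof (induction "D - dim (y \<inter> x)" arbitrary: y rule: less_induct)
  case (less y)
  have y: "subspace y" "dim y = D" using less.prems by (auto simp: X_iff)
  have yx: "subspace (y \<inter> x)" using y x_subspace by (simp add: subspace_inter)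
  show ?case
  proof (cases "y = x")
    case True
    show ?thesis unfolding True by (simp add: dim_x)
  next
    case False
    then have "\<not> x \<subseteq> y" using subspace_eqI[of x y] x_subspace dim_x y by auto
    then obtain v where v: "v \<in> x" "v \<notin> y" by blast
    have "\<not> y \<subseteq> x" using False subspace_eqI[of y x] x_subspace dim_x y by auto
    then obtain p where p: "p \<in> y" "p \<notin> x" by blast
    then obtain h where h: "subspace h" "y \<inter> x \<subseteq> h" "h \<subseteq> y" "Suc (dim h) = D"
      using exists_hyperplane_avoiding[OF y(1) yx, of p] y by auto
    define z where "z = span (insert v h)"
    have "v \<notin> h" using v h by blast
    then have z: "subspace z" "dim z = D" "h \<subseteq> z" "v \<in> z"
      unfolding z_def using dim_span_insert[OF h(1)] h span_superset[of "insert v h"] by auto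
    have "h \<subseteq> z \<inter> y" using z h by blast
    then have "dim h \<le> dim (z \<inter> y)" by (rule dim_subset)
    moreover have "dim (z \<inter> y) \<noteq> D"
    proof
      assume "dim (z \<inter> y) = D"
      then have "z \<inter> y = z" using z y subspace_eqI[of "z \<inter> y" z] by (auto simp: subspace_inter)
      then show False using z v by blast
    qed
    moreover have "dim (z \<inter> y) \<le> D" using dim_subset[of "z \<inter> y" y] y by simp
    ultimately have e: "(z, y) \<in> E" using z y h by (auto simp: E_iff X_iff)
    have "span (insert v (y \<inter> x)) \<subseteq> z \<inter> x"
      using z h v x_subspace by (intro span_minimal) (auto simp: subspace_inter)
    then have "Suc (dim (y \<inter> x)) \<le> dim (z \<inter> x)"
      using dim_span_insert[OF yx, of v] v dim_subset[of "span (insert v (y \<inter> x))" "z \<inter> x"] by simp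
    then have d: "dim (z \<inter> x) = Suc (dim (y \<inter> x))" using adjacent_dim_Int[OF e] by simp
    have zX: "z \<in> X" using z by (simp add: X_iff)
    have "D - dim (y \<inter> x) = Suc (D - dim (z \<inter> x))" using d dim_Int_x_le[OF zX] by simp
    moreover from this have "(x, z) \<in> E ^^ (D - dim (z \<inter> x))" using zX by (intro less.hyps) auto
    ultimately show ?thesis using e by (metis relpow_Suc_I)
  qed
qed

lemma path_distance_eq:
  assumes "y \<in> X"
  shows "path_distance scale D x y = D - dim (y \<inter> x)"
  unfolding path_distance_def
proof (rule Least_equality)
  show "D - dim (y \<inter> x) \<le> n" if "(x, y) \<in> E ^^ n" for n
    using path_dim_Int[OF that] by simp
qed (rule exists_path[OF assms])

lemma dual_idem_nth:
  "(dual_idem scale D x i *v v) $ y = (if y \<in> X \<and> D - dim (y \<inter> x) = i then v $ y else 0)"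
proof -
  have "(dual_idem scale D x i *v v) $ y
      = (\<Sum>z\<in>UNIV. if z = y then (if y \<in> X \<and> D - dim (y \<inter> x) = i then v $ y else 0) else 0)"
    unfolding matrix_vector_nth
    by (intro sum.cong refl) (auto simp: dual_idem_def path_distance_eq)
  then show ?thesis by simp
qed

lemma card_covers_containing:
  assumes h: "subspace h" "Suc (dim h) = D" and a: "subspace a"
  shows "real (card {y \<in> X. h \<subseteq> y \<and> a \<subseteq> y})
    = (if a \<subseteq> h then qint q (N - D + 1) else of_bool (dim (join a h) = D))"
proof (cases "a \<subseteq> h")
  case True
  have "{y \<in> X. h \<subseteq> y \<and> a \<subseteq> y} = between h UNIV (Suc (dim h))"
    using True h by (auto simp: between_def X_iff)
  moreover have "N - dim h = N - D + 1" using h two_D_less by simp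
  ultimately show ?thesis using card_between_Suc[of h UNIV] h True by simp
next
  case False
  have eq: "y = join a h \<and> dim (join a h) = D" if "y \<in> X" "h \<subseteq> y" "a \<subseteq> y" for y
  proof -
    have y: "subspace y" "dim y = D" using that by (auto simp: X_iff)
    have sub: "join a h \<subseteq> y" using that y by (simp add: join_le_iff)
    have "dim h < dim (join a h)"
    proof (rule ccontr)
      assume "\<not> dim h < dim (join a h)"
      then have "h = join a h" using h join_ge[of h a] join_ge(2)[of h a] by (intro subspace_eqI) auto
      then show False using False join_ge(1)[of a h] by simp
    qed
    moreover have "dim (join a h) \<le> D" using dim_subset[OF sub] y by simp
    ultimately have "dim (join a h) = D" using h by simp
    then show ?thesis using subspace_eqI[OF _ y(1) sub] y by simp
  qed
  show ?thesis
  proof (cases "dim (join a h) = D")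
    case True
    have "{y \<in> X. h \<subseteq> y \<and> a \<subseteq> y} = {join a h}"
    proof (intro equalityI subsetI)
      fix y assume "y \<in> {y \<in> X. h \<subseteq> y \<and> a \<subseteq> y}"
      then have "y = join a h" using eq by simp
      then show "y \<in> {join a h}" by simp
    qed (use True join_ge(1)[of a h] join_ge(2)[of h a] in \<open>simp add: X_iff\<close>)
    then show ?thesis using True False by simp
  next
    case F: False
    then have empty: "{y \<in> X. h \<subseteq> y \<and> a \<subseteq> y} = {}" using eq by blast
    show ?thesis unfolding empty using F False by simp
  qed
qed

section \<open>Counting the neighbours that contain a subspace\<close>

lemma adjacent_iff_dim_join:
  assumes "y \<in> X" "z \<in> X"
  shows "(z, y) \<in> E \<longleftrightarrow> dim (join z y) = Suc D"
  using dim_join[of z y] assms D_ge_1 by (auto simp: E_iff X_iff)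

text \<open>A neighbour of z contains exactly one hyperplane of z, while z itself contains all [D]
  of them; the second summand pays for this overcount.\<close>

lemma card_neighbours_via_hyperplanes:
  assumes z: "z \<in> X"
  shows "real (card {y. (z, y) \<in> E \<and> a \<subseteq> y}) + qint q D * of_bool (a \<subseteq> z)
    = (\<Sum>h | subspace h \<and> h \<subseteq> z \<and> Suc (dim h) = D. real (card {y \<in> X. h \<subseteq> y \<and> a \<subseteq> y}))"
proof -
  let ?S = "{h. subspace h \<and> h \<subseteq> z \<and> Suc (dim h) = D}" and ?Y = "{y \<in> X. a \<subseteq> y}"
  have zs: "subspace z" "dim z = D" using z by (auto simp: X_iff)
  have cnt: "real (card {h \<in> ?S. h \<subseteq> y}) = (if z = y then qint q D else of_bool ((z, y) \<in> E))"
    if y: "y \<in> X" for y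
  proof -
    have b: "z \<in> between {0} UNIV D" "y \<in> between {0} UNIV D"
      using y z subspace_0 by (auto simp: between_def X_iff)
    have "{h \<in> ?S. h \<subseteq> y} = {d. (subspace d \<and> {0} \<subseteq> d \<and> Suc (dim d) = D) \<and> d \<subseteq> z \<and> d \<subseteq> y}"
      using subspace_0 by auto
    then show ?thesis
      using card_common_cocovers[OF _ b] adjacent_iff_dim_join[OF y z] by simp
  qed
  have "(\<Sum>h\<in>?S. real (card {y \<in> X. h \<subseteq> y \<and> a \<subseteq> y})) = (\<Sum>h\<in>?S. real (card {y \<in> ?Y. h \<subseteq> y}))"
    by (intro sum.cong refl arg_cong[where f = "\<lambda>s. real (card s)"]) auto
  also have "\<dots> = (\<Sum>y\<in>?Y. real (card {h \<in> ?S. h \<subseteq> y}))"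
    unfolding of_nat_sum[symmetric] by (rule arg_cong[where f = real], rule sum_multicount_gen) auto
  also have "\<dots> = (\<Sum>y\<in>?Y. (if y = z then qint q D else 0) + of_bool ((z, y) \<in> E))"
  proof (intro sum.cong refl)
    fix y assume "y \<in> ?Y"
    moreover have "(z, z) \<notin> E" using zs D_ge_1 by (auto simp: E_iff)
    ultimately show "real (card {h \<in> ?S. h \<subseteq> y}) = (if y = z then qint q D else 0) + of_bool ((z, y) \<in> E)"
      using cnt[of y] by auto
  qed
  also have "\<dots> = qint q D * of_bool (a \<subseteq> z) + real (card {y \<in> ?Y. (z, y) \<in> E})"
  proof -
    have "(\<Sum>y\<in>?Y. if y = z then qint q D else 0) = qint q D * of_bool (a \<subseteq> z)"
      using z by (simp add: sum.delta)
    moreover have "(\<Sum>y\<in>?Y. of_bool ((z, y) \<in> E)) = real (card {y \<in> ?Y. (z, y) \<in> E})"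
      by (simp only: sum_of_bool_card finite)
    ultimately show ?thesis by (simp only: sum.distrib)
  qed
  also have "{y \<in> ?Y. (z, y) \<in> E} = {y. (z, y) \<in> E \<and> a \<subseteq> y}" by (auto simp: E_iff)
  finally show ?thesis by simp
qed

lemma theta_eq: "\<theta> i = q * qint q D * qint q (N - D) - qint q i * qint q (N - i + 1)"
  by (simp add: theta_def Let_def q_eq)

text \<open>For \<open>a \<subseteq> z\<close> the neighbour count is the right side; the identity
  splits it into the eigenvalue and the contribution of the [i] hyperplanes of a.\<close>

lemma theta_identity:
  assumes i: "i \<le> D"
  shows "\<theta> i + qint q (D - i + 1) * qint q i = q * qint q (D - i) * qint q (N - D)"
proof -
  define p r s where "p = q ^ i" "r = q ^ (D - i)" "s = q ^ (N - D)"
  have "q ^ D = p * r" using i by (simp add: p_r_s_def flip: power_add)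
  moreover have "q ^ (N - i + 1) = q * r * s"
    using i two_D_less by (simp add: p_r_s_def flip: power_add power_Suc)
  moreover have "q ^ (D - i + 1) = q * r" by (simp add: p_r_s_def)
  ultimately have e: "qint q D = (p * r - 1) / (q - 1)" "qint q (N - D) = (s - 1) / (q - 1)"
    "qint q i = (p - 1) / (q - 1)" "qint q (N - i + 1) = (q * r * s - 1) / (q - 1)"
    "qint q (D - i + 1) = (q * r - 1) / (q - 1)" "qint q (D - i) = (r - 1) / (q - 1)"
    by (simp_all add: qint_def p_r_s_def)
  have "q - 1 \<noteq> 0" using q_ne_1 by simp
  then show ?thesis unfolding theta_eq e by (simp add: divide_simps) algebra
qed

text \<open>The difference of the eigenvalues factors as (b - a) (d - 1) / (q - 1)^2, and a < b
  because i + j < N + 1.\<close>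

lemma theta_strict_antimono:
  assumes "i < j" "j \<le> D"
  shows "\<theta> j < \<theta> i"
proof -
  define a b d where "a = q ^ i" "b = q ^ (N - j + 1)" "d = q ^ (j - i)"
  have "q ^ j = a * d" using assms by (simp add: a_b_d_def flip: power_add)
  moreover have "q ^ (N - i + 1) = b * d"
    using assms two_D_less by (simp add: a_b_d_def flip: power_add power_Suc)
  ultimately have e: "qint q i = (a - 1) / (q - 1)" "qint q j = (a * d - 1) / (q - 1)"
    "qint q (N - i + 1) = (b * d - 1) / (q - 1)" "qint q (N - j + 1) = (b - 1) / (q - 1)"
    by (simp_all add: qint_def a_b_d_def)
  have "a < b" unfolding a_b_d_def using q_gt_1 assms two_D_less by (intro power_strict_increasing) auto
  moreover have "1 < d" unfolding a_b_d_def using q_gt_1 assms by (intro one_less_power) auto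
  ultimately have "0 < (b - a) * (d - 1)" by simp
  then have "0 < (b - a) * (d - 1) / (q - 1)\<^sup>2" using q_gt_1 by simp
  moreover have "qint q j * qint q (N - j + 1) - qint q i * qint q (N - i + 1)
      = (b - a) * (d - 1) / (q - 1)\<^sup>2"
    unfolding e by (simp add: power2_eq_square flip: diff_divide_distrib) (simp add: algebra_simps)
  ultimately show ?thesis unfolding theta_eq by linarith
qed

lemma theta_inject: "i \<le> D \<Longrightarrow> j \<le> D \<Longrightarrow> \<theta> i = \<theta> j \<longleftrightarrow> i = j"
  by (metis less_irrefl linorder_neqE_nat theta_strict_antimono)

lemma card_neighbours_containing:
  assumes z: "z \<in> X" and a: "subspace a" "dim a \<le> D"
  shows "real (card {y. (z, y) \<in> E \<and> a \<subseteq> y}) = \<theta> (dim a) * of_bool (a \<subseteq> z)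
    + qint q (D - dim a + 1) * real (card {b. (subspace b \<and> b \<subseteq> a \<and> Suc (dim b) = dim a) \<and> b \<subseteq> z})"
proof -
  let ?i = "dim a"
  let ?S = "{h. subspace h \<and> h \<subseteq> z \<and> Suc (dim h) = D}"
  let ?B = "{b. (subspace b \<and> b \<subseteq> a \<and> Suc (dim b) = ?i) \<and> b \<subseteq> z}"
  have zs: "subspace z" "dim z = D" using z by (auto simp: X_iff)
  have hyp: "{h \<in> ?S. w \<subseteq> h} = {h. subspace h \<and> w \<subseteq> h \<and> h \<subseteq> z \<and> Suc (dim h) = dim z}" for w
    using zs by auto
  have via: "real (card {y. (z, y) \<in> E \<and> a \<subseteq> y}) + qint q D * of_bool (a \<subseteq> z)
      = (\<Sum>h\<in>?S. if a \<subseteq> h then qint q (N - D + 1) else of_bool (dim (join a h) = D))"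
    unfolding card_neighbours_via_hyperplanes[OF z]
    by (intro sum.cong refl card_covers_containing a) auto
  show ?thesis
  proof (cases "a \<subseteq> z")
    case True
    have "{0} \<subseteq> z" using subspace_0 zs by auto
    then have cS: "real (card ?S) = qint q D"
      using card_between_hyperplanes[of "{0}" z] zs hyp[of "{0}"] subspace_0 by (simp cong: conj_cong)
    have cSa: "real (card {h \<in> ?S. a \<subseteq> h}) = qint q (D - ?i)"
      using card_between_hyperplanes[of a z] zs a True unfolding hyp by simp
    \<comment> \<open>A hyperplane of \<open>z\<close> that does not contain \<open>a\<close> spans
      \<open>z\<close> together with it and counts only \<open>z\<close>.\<close>
    have "(\<Sum>h\<in>?S. if a \<subseteq> h then qint q (N - D + 1) else of_bool (dim (join a h) = D))
        = (\<Sum>h\<in>?S. 1 + of_bool (a \<subseteq> h) * (qint q (N - D + 1) - 1))"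
    proof (intro sum.cong refl)
      fix h assume h: "h \<in> ?S"
      have "dim (join a h) = D" if "\<not> a \<subseteq> h"
      proof -
        have sub: "join a h \<subseteq> z" using True h zs by (simp add: join_le_iff)
        have "\<not> dim (join a h) \<le> dim h"
        proof
          assume "dim (join a h) \<le> dim h"
          then have "h = join a h" using h join_ge(2)[of h a] by (intro subspace_eqI) auto
          then show False using that join_ge(1)[of a h] by simp
        qed
        then show ?thesis using dim_subset[OF sub] h zs by simp
      qed
      then show "(if a \<subseteq> h then qint q (N - D + 1) else of_bool (dim (join a h) = D))
          = 1 + of_bool (a \<subseteq> h) * (qint q (N - D + 1) - 1)" by simp
    qed
    also have "\<dots> = real (card ?S) + real (card {h \<in> ?S. a \<subseteq> h}) * (qint q (N - D + 1) - 1)"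
    proof -
      have "(\<Sum>h\<in>?S. of_bool (a \<subseteq> h)) = real (card {h \<in> ?S. a \<subseteq> h})"
        by (simp only: sum_of_bool_card finite)
      then show ?thesis by (simp only: sum.distrib sum_distrib_right[symmetric]) simp
    qed
    also have "\<dots> = qint q D + qint q (D - ?i) * (q * qint q (N - D))"
    proof -
      have "qint q (N - D + 1) - 1 = q * qint q (N - D)"
        using qint_add[OF q_ne_1, of 1 "N - D"] q_ne_1 by (simp add: add.commute)
      then show ?thesis by (simp only: cS cSa)
    qed
    finally have "real (card {y. (z, y) \<in> E \<and> a \<subseteq> y}) = qint q (D - ?i) * (q * qint q (N - D))"
      using via True by simp
    moreover have "real (card ?B) = qint q ?i"
    proof -
      have "{0} \<subseteq> a" using subspace_0 a by auto
      moreover have "?B = {b. subspace b \<and> {0} \<subseteq> b \<and> b \<subseteq> a \<and> Suc (dim b) = dim a}"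
        using True subspace_0 by auto
      ultimately show ?thesis using card_between_hyperplanes[of "{0}" a] a by simp
    qed
    ultimately show ?thesis using theta_identity[OF a(2)] True by (simp add: mult_ac)
  next
    case False
    let ?w = "a \<inter> z"
    have w: "subspace ?w" using a zs by (simp add: subspace_inter)
    have wa: "dim ?w < ?i"
    proof (rule ccontr)
      assume "\<not> dim ?w < ?i"
      then have "?w = a" using w a by (intro subspace_eqI) auto
      then show False using False by blast
    qed
    \<comment> \<open>When \<open>a\<close> is not inside \<open>z\<close>, a hyperplane contributes
      only if it contains \<open>a \<inter> z\<close> and this is a hyperplane of \<open>a\<close>.
      That is then the only member of \<open>?B\<close>.\<close>
    have hw: "dim (join a h) = D \<longleftrightarrow> Suc (dim ?w) = ?i \<and> ?w \<subseteq> h" if h: "h \<in> ?S" for h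
    proof -
      have d: "dim (join a h) + dim (a \<inter> h) = ?i + dim h" using dim_join a h by blast
      have sub: "a \<inter> h \<subseteq> ?w" using h by blast
      then have le: "dim (a \<inter> h) \<le> dim ?w" by (rule dim_subset)
      have hD: "Suc (dim h) = D" using h by blast
      show ?thesis
      proof
        assume "dim (join a h) = D"
        then have w': "dim (a \<inter> h) = dim ?w" "Suc (dim ?w) = ?i" using d le wa hD by auto
        then have "a \<inter> h = ?w"
          using sub w h a by (intro subspace_eqI) (auto simp: subspace_inter)
        then show "Suc (dim ?w) = ?i \<and> ?w \<subseteq> h" using w' by blast
      next
        assume w': "Suc (dim ?w) = ?i \<and> ?w \<subseteq> h"
        then have "a \<inter> h = ?w" using h by blast
        then show "dim (join a h) = D" using d w' hD by simp
      qed
    qed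
    have "real (card {y. (z, y) \<in> E \<and> a \<subseteq> y})
        = (\<Sum>h\<in>?S. of_bool (Suc (dim ?w) = ?i \<and> ?w \<subseteq> h))"
    proof -
      have "(\<Sum>h\<in>?S. if a \<subseteq> h then qint q (N - D + 1) else of_bool (dim (join a h) = D))
          = (\<Sum>h\<in>?S. of_bool (Suc (dim ?w) = ?i \<and> ?w \<subseteq> h))"
      proof (intro sum.cong refl)
        fix h assume h: "h \<in> ?S"
        then have "\<not> a \<subseteq> h" using False by blast
        then show "(if a \<subseteq> h then qint q (N - D + 1) else of_bool (dim (join a h) = D))
            = of_bool (Suc (dim ?w) = ?i \<and> ?w \<subseteq> h)" by (simp only: if_False hw[OF h])
      qed
      then show ?thesis using via False by simp
    qed
    also have "\<dots> = real (card {h \<in> ?S. Suc (dim ?w) = ?i \<and> ?w \<subseteq> h})"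
      by (simp only: sum_of_bool_card finite)
    also have "\<dots> = qint q (D - ?i + 1) * real (card ?B)"
    proof (cases "Suc (dim ?w) = ?i")
      case True
      have "b = ?w" if "b \<in> ?B" for b
        using that True w by (intro subspace_eqI) auto
      moreover have "?w \<in> ?B" using True w by simp
      ultimately have B: "?B = {?w}" by blast
      have S: "{h \<in> ?S. Suc (dim ?w) = ?i \<and> ?w \<subseteq> h} = {h \<in> ?S. ?w \<subseteq> h}" using True by simp
      have "D - dim ?w = D - ?i + 1" using True a by simp
      then show ?thesis
        unfolding B S hyp using card_between_hyperplanes[of ?w z] w zs by simp
    next
      case F: False
      have "False" if "b \<in> ?B" for b
      proof -
        have "b \<subseteq> ?w" using that by blast
        then show False using dim_subset[of b ?w] that F wa by simp
      qed
      then have B: "?B = {}" by blast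
      have S: "{h \<in> ?S. Suc (dim ?w) = ?i \<and> ?w \<subseteq> h} = {}" using F by simp
      show ?thesis unfolding B S by simp
    qed
    finally show ?thesis using False by simp
  qed
qed

section \<open>The eigenspaces of the adjacency matrix\<close>

definition eta :: "'v set \<Rightarrow> complex ^ 'v set" where
  "eta a = (\<chi> y. of_bool (y \<in> X \<and> a \<subseteq> y))"

lemma eta_nth: "eta a $ y = of_bool (y \<in> X \<and> a \<subseteq> y)"
  by (simp add: eta_def)

lemma standard_module_iff: "v \<in> V \<longleftrightarrow> (\<forall>y. y \<notin> X \<longrightarrow> v $ y = 0)"
  by (simp add: standard_module_def)

lemma subspace_standard_module: "vec.subspace V"
  by (auto simp: vec.subspace_def standard_module_iff)

lemma eta_in_standard_module: "eta a \<in> V"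
  by (simp add: standard_module_iff eta_nth)

text \<open>\<open>A\<close> acts triangularly with respect to dimension, with the eigenvalues on
  the diagonal. Both inclusions between eigenspaces and spans of the \<open>eta a\<close> rest on
  this.\<close>

lemma adjacency_eta:
  assumes a: "subspace a" "dim a \<le> D"
  shows "A *v eta a = of_real (\<theta> (dim a)) *s eta a
    + of_real (qint q (D - dim a + 1)) *s (\<Sum>b | subspace b \<and> b \<subseteq> a \<and> Suc (dim b) = dim a. eta b)"
proof (rule vec_eq_iff[THEN iffD2], rule allI)
  fix z
  let ?B = "{b. subspace b \<and> b \<subseteq> a \<and> Suc (dim b) = dim a}"
  have l: "(A *v eta a) $ z = of_nat (card {y. (z, y) \<in> E \<and> a \<subseteq> y})"
  proof -
    have "(A *v eta a) $ z = (\<Sum>y\<in>UNIV. of_bool ((z, y) \<in> E \<and> a \<subseteq> y))"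
      unfolding matrix_vector_nth
      by (intro sum.cong refl) (auto simp: adjacency_matrix_def eta_nth E_iff)
    then show ?thesis by simp
  qed
  have s: "(\<Sum>b\<in>?B. eta b) $ z = (if z \<in> X then of_nat (card {b \<in> ?B. b \<subseteq> z}) else 0)"
    by (simp add: sum_component eta_nth Int_def)
  show "(A *v eta a) $ z = (of_real (\<theta> (dim a)) *s eta a
      + of_real (qint q (D - dim a + 1)) *s (\<Sum>b\<in>?B. eta b)) $ z"
  proof (cases "z \<in> X")
    case True
    have "complex_of_real (real (card {y. (z, y) \<in> E \<and> a \<subseteq> y}))
        = of_real (\<theta> (dim a) * of_bool (a \<subseteq> z) + qint q (D - dim a + 1) * real (card {b \<in> ?B. b \<subseteq> z}))"
      using card_neighbours_containing[OF True a] by simp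
    then show ?thesis
      unfolding l vector_add_component vector_smult_component s eta_nth using True by simp
  next
    case False
    then have "{y. (z, y) \<in> E \<and> a \<subseteq> y} = {}" by (auto simp: E_iff)
    then show ?thesis
      unfolding l vector_add_component vector_smult_component s eta_nth using False by simp
  qed
qed

text \<open>The bound is strict, so that \<open>A - \<theta>\<^sub>i\<close> maps \<open>U (i + 1)\<close> into \<open>U i\<close> and \<open>U 0 = {0}\<close>.\<close>

definition U :: "nat \<Rightarrow> (complex ^ 'v set) set" where
  "U t = vec.span {eta a | a. subspace a \<and> dim a < t}"

lemma eta_in_U: "subspace a \<Longrightarrow> dim a < t \<Longrightarrow> eta a \<in> U t"
  unfolding U_def by (intro vec.span_base) blast

lemma subspace_U: "vec.subspace (U t)"
  by (simp add: U_def)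

lemma adjacency_U:
  assumes "v \<in> U (Suc i)" "i \<le> D"
  shows "A *v v - of_real (\<theta> i) *s v \<in> U i"
  using assms(1) unfolding U_def[of "Suc i"]
proof (rule vec.span_induct)
  show "vec.subspace {v. A *v v - of_real (\<theta> i) *s v \<in> U i}"
  proof (rule vec.subspaceI)
    fix v w assume "v \<in> {v. A *v v - of_real (\<theta> i) *s v \<in> U i}" "w \<in> {v. A *v v - of_real (\<theta> i) *s v \<in> U i}"
    then have "(A *v v - of_real (\<theta> i) *s v) + (A *v w - of_real (\<theta> i) *s w) \<in> U i"
      using subspace_U by (auto intro: vec.subspace_add)
    then show "v + w \<in> {v. A *v v - of_real (\<theta> i) *s v \<in> U i}"
      by (simp add: vec.add vec.scale_right_distrib algebra_simps)
  next
    fix c v assume "v \<in> {v. A *v v - of_real (\<theta> i) *s v \<in> U i}"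
    then have "c *s (A *v v - of_real (\<theta> i) *s v) \<in> U i"
      by (intro vec.subspace_scale[OF subspace_U]) simp
    then show "c *s v \<in> {v. A *v v - of_real (\<theta> i) *s v \<in> U i}"
      by (simp add: vec.scale vec.scale_right_diff_distrib mult.commute)
  qed (use subspace_U vec.subspace_0 in auto)
next
  fix v assume "v \<in> {eta a | a. subspace a \<and> dim a < Suc i}"
  then obtain a where a: "v = eta a" "subspace a" "dim a \<le> i" by auto
  let ?s = "\<Sum>b | subspace b \<and> b \<subseteq> a \<and> Suc (dim b) = dim a. eta b"
  have s: "?s \<in> U i" using a by (intro vec.subspace_sum[OF subspace_U] eta_in_U) auto
  have "(of_real (\<theta> (dim a)) - of_real (\<theta> i)) *s eta a \<in> U i"
  proof (cases "dim a = i")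
    case False
    then show ?thesis using a by (intro vec.subspace_scale[OF subspace_U] eta_in_U) auto
  qed (simp add: vec.subspace_0[OF subspace_U])
  then have "(of_real (\<theta> (dim a)) - of_real (\<theta> i)) *s eta a
      + of_real (qint q (D - dim a + 1)) *s ?s \<in> U i"
    by (rule vec.subspace_add[OF subspace_U _ vec.subspace_scale[OF subspace_U s]])
  then show "A *v v - of_real (\<theta> i) *s v \<in> U i"
    using adjacency_eta[of a] a assms(2) by (simp add: vec.scale_left_diff_distrib algebra_simps)
qed

lemma eta_vertex:
  assumes "y \<in> X"
  shows "eta y $ z = of_bool (z = y)"
proof -
  have "y = z" if "z \<in> X" "y \<subseteq> z"
    using assms that by (intro subspace_eqI) (simp_all add: X_iff)
  then have "z \<in> X \<and> y \<subseteq> z \<longleftrightarrow> z = y" using assms by blast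
  then show ?thesis by (simp only: eta_nth)
qed

lemma standard_module_eq_sum_eta:
  assumes "v \<in> V"
  shows "v = (\<Sum>y\<in>X. v $ y *s eta y)"
proof (rule vec_eq_iff[THEN iffD2], rule allI)
  fix z
  have "(\<Sum>y\<in>X. v $ y *s eta y) $ z = (\<Sum>y\<in>X. if y = z then v $ z else 0)"
    unfolding sum_component by (intro sum.cong refl) (auto simp: eta_vertex)
  then show "v $ z = (\<Sum>y\<in>X. v $ y *s eta y) $ z"
    using assms by (simp add: standard_module_iff)
qed

lemma standard_module_subset_U: "V \<subseteq> U (Suc D)"
proof
  fix v assume "v \<in> V"
  then have v: "v = (\<Sum>y\<in>X. v $ y *s eta y)" by (rule standard_module_eq_sum_eta)
  show "v \<in> U (Suc D)"
    by (subst v, intro vec.subspace_sum[OF subspace_U] vec.subspace_scale[OF subspace_U] eta_in_U)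
      (auto simp: X_iff)
qed

lemma Eig_iff: "v \<in> Eig i \<longleftrightarrow> v \<in> V \<and> A *v v = of_real (\<theta> i) *s v"
  by (simp add: theta_eigenspace_def)

lemma subspace_Eig: "vec.subspace (Eig i)"
  using subspace_standard_module
  by (auto simp: vec.subspace_def Eig_iff vec.add vec.scale vec.scale_right_distrib mult.commute)

text \<open>Descend from \<open>U (D + 1)\<close>, which contains every vector of \<open>V\<close>:
  while i + 1 > t, the operator A - \<theta> (i + 1) lowers the degree but multiplies v by a nonzero
  scalar.\<close>

lemma Eig_subset_U:
  assumes "t \<le> D"
  shows "Eig t \<subseteq> U (Suc t)"
proof
  fix v assume v: "v \<in> Eig t"
  from assms show "v \<in> U (Suc t)"
  proof (induction rule: inc_induct)
    case base
    then show ?case using v standard_module_subset_U by (auto simp: Eig_iff)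
  next
    case (step i)
    let ?c = "complex_of_real (\<theta> t) - of_real (\<theta> (Suc i))"
    have "A *v v - of_real (\<theta> (Suc i)) *s v \<in> U (Suc i)"
      using step by (intro adjacency_U) auto
    then have "?c *s v \<in> U (Suc i)" using v by (simp add: Eig_iff vec.scale_left_diff_distrib)
    then have "inverse ?c *s (?c *s v) \<in> U (Suc i)" by (rule vec.subspace_scale[OF subspace_U])
    moreover have "?c \<noteq> 0" using theta_strict_antimono[of t "Suc i"] step by simp
    then have "inverse ?c * ?c = 1" by simp
    then have "inverse ?c *s (?c *s v) = v" by (simp only: vec.scale_scale vec.scale_one)
    ultimately show ?case by metis
  qed
qed

text \<open>A - \<theta> i acts on each earlier eigenspace by a nonzero scalar, hence maps their
  span onto itself.\<close>

lemma Eig_span_solve: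
  assumes "g \<in> vec.span (\<Union>j<i. Eig j)" "i \<le> D"
  shows "\<exists>g'\<in>vec.span (\<Union>j<i. Eig j). A *v g' - of_real (\<theta> i) *s g' = g"
  using assms(1)
proof (rule vec.span_induct)
  let ?S = "vec.span (\<Union>j<i. Eig j)"
  let ?R = "\<lambda>g. \<exists>g'\<in>?S. A *v g' - of_real (\<theta> i) *s g' = g"
  show "vec.subspace {g. ?R g}"
  proof (rule vec.subspaceI)
    show "0 \<in> {g. ?R g}" by (auto intro!: bexI[of _ 0] vec.span_zero)
  next
    fix g h assume "g \<in> {g. ?R g}" "h \<in> {g. ?R g}"
    then obtain g' h' where S: "g' \<in> ?S" "h' \<in> ?S" and gh: "g = A *v g' - of_real (\<theta> i) *s g'"
      "h = A *v h' - of_real (\<theta> i) *s h'" by auto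
    have "A *v (g' + h') - of_real (\<theta> i) *s (g' + h') = g + h"
      unfolding gh by (simp add: vec.add vec.scale_right_distrib algebra_simps)
    then show "g + h \<in> {g. ?R g}" using S by (intro CollectI bexI[of _ "g' + h'"] vec.span_add)
  next
    fix c g assume "g \<in> {g. ?R g}"
    then obtain g' where S: "g' \<in> ?S" and g: "g = A *v g' - of_real (\<theta> i) *s g'" by auto
    have "A *v (c *s g') - of_real (\<theta> i) *s (c *s g') = c *s g"
      unfolding g by (simp add: vec.scale vec.scale_right_diff_distrib mult.commute)
    then show "c *s g \<in> {g. ?R g}" using S by (intro CollectI bexI[of _ "c *s g'"] vec.span_scale)
  qed
  fix g assume "g \<in> (\<Union>j<i. Eig j)"
  then obtain j where j: "j < i" "g \<in> Eig j" by blast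
  let ?c = "complex_of_real (\<theta> j) - of_real (\<theta> i)"
  have "?c \<noteq> 0" using theta_strict_antimono[of j i] j assms by simp
  then have c: "inverse ?c * ?c = 1" by simp
  have g: "g \<in> ?S" using j by (intro vec.span_base) blast
  have "A *v (inverse ?c *s g) - of_real (\<theta> i) *s (inverse ?c *s g) = inverse ?c *s (?c *s g)"
    using j by (simp only: vec.scale Eig_iff vec.scale_left_diff_distrib vec.scale_right_diff_distrib
        vec.scale_scale mult.commute)
  also have "\<dots> = g" by (simp only: vec.scale_scale c vec.scale_one)
  finally show "?R g" using g by (intro bexI[of _ "inverse ?c *s g"] vec.span_scale) auto
qed

text \<open>By induction the lower term of \<open>adjacency_eta\<close> lies in the earlier
  eigenspaces. Solving there for g makes \<open>eta a - g\<close> an eigenvector.\<close>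

lemma eta_in_span_Eig:
  assumes "subspace a" "dim a \<le> D"
  shows "eta a \<in> vec.span (\<Union>j\<le>dim a. Eig j)"
  using assms
proof (induction "dim a" arbitrary: a rule: less_induct)
  case (less a)
  let ?i = "dim a" and ?B = "{b. subspace b \<and> b \<subseteq> a \<and> Suc (dim b) = dim a}"
  let ?S = "vec.span (\<Union>j<?i. Eig j)"
  have "eta b \<in> ?S" if b: "b \<in> ?B" for b
  proof -
    have "eta b \<in> vec.span (\<Union>j\<le>dim b. Eig j)" using b less.prems by (intro less.hyps) auto
    also have "\<dots> \<subseteq> ?S" using b by (intro vec.span_mono) force
    finally show ?thesis .
  qed
  then have "of_real (qint q (D - ?i + 1)) *s (\<Sum>b\<in>?B. eta b) \<in> ?S"
    by (intro vec.span_scale vec.span_sum) auto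
  then obtain g where g: "g \<in> ?S"
      "A *v g - of_real (\<theta> ?i) *s g = of_real (qint q (D - ?i + 1)) *s (\<Sum>b\<in>?B. eta b)"
    using Eig_span_solve less.prems by blast
  have "vec.span (\<Union>j<?i. Eig j) \<subseteq> V"
    using subspace_standard_module by (intro vec.span_minimal) (auto simp: Eig_iff)
  then have "eta a - g \<in> V"
    using g eta_in_standard_module subspace_standard_module by (blast intro: vec.subspace_diff)
  moreover have "A *v (eta a - g) = of_real (\<theta> ?i) *s (eta a - g)"
    using adjacency_eta[OF less.prems] g(2) by (simp add: vec.diff vec.scale_right_diff_distrib algebra_simps)
  ultimately have "eta a - g \<in> Eig ?i" by (simp add: Eig_iff)
  then have "eta a - g \<in> vec.span (\<Union>j\<le>?i. Eig j)" by (intro vec.span_base) blast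
  moreover have "g \<in> vec.span (\<Union>j\<le>?i. Eig j)"
    using g(1) vec.span_mono[of "\<Union>j<?i. Eig j" "\<Union>j\<le>?i. Eig j"] by force
  ultimately have "eta a - g + g \<in> vec.span (\<Union>j\<le>?i. Eig j)" by (rule vec.span_add)
  then show ?case by simp
qed

lemma standard_module_subset_span_Eig: "V \<subseteq> vec.span (\<Union>j\<le>D. Eig j)"
proof
  fix v assume "v \<in> V"
  then have v: "v = (\<Sum>y\<in>X. v $ y *s eta y)" by (rule standard_module_eq_sum_eta)
  have "eta y \<in> vec.span (\<Union>j\<le>D. Eig j)" if "y \<in> X" for y
    using eta_in_span_Eig[of y] that by (auto simp: X_iff)
  then show "v \<in> vec.span (\<Union>j\<le>D. Eig j)"
    by (subst v) (intro vec.span_sum vec.span_scale)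
qed

end

section \<open>Modules of the Terwilliger algebra\<close>

lemma hermitian_inner_add_left: "hermitian_inner (u + v) w = hermitian_inner u w + hermitian_inner v w"
  by (simp add: hermitian_inner_def distrib_right sum.distrib)

lemma hermitian_inner_diff_left: "hermitian_inner (u - v) w = hermitian_inner u w - hermitian_inner v w"
  by (simp add: hermitian_inner_def left_diff_distrib sum_subtractf)

lemma hermitian_inner_scale_left: "hermitian_inner (c *s v) w = c * hermitian_inner v w"
  by (simp add: hermitian_inner_def sum_distrib_left mult.assoc)

lemma hermitian_inner_add_right: "hermitian_inner w (u + v) = hermitian_inner w u + hermitian_inner w v"
  by (simp add: hermitian_inner_def distrib_left sum.distrib)

lemma hermitian_inner_scale_right: "hermitian_inner w (c *s v) = cnj c * hermitian_inner w v"
  by (simp add: hermitian_inner_def sum_distrib_left mult_ac)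

lemma hermitian_inner_zero_left [simp]: "hermitian_inner 0 w = 0"
  and hermitian_inner_zero_right [simp]: "hermitian_inner w 0 = 0"
  by (simp_all add: hermitian_inner_def)

lemma hermitian_inner_self_eq_0:
  assumes "hermitian_inner v v = 0"
  shows "v = 0"
proof -
  have "hermitian_inner v v = of_real (\<Sum>y\<in>UNIV. (cmod (v $ y))\<^sup>2)"
    unfolding hermitian_inner_def of_real_sum
    by (intro sum.cong refl complex_norm_square[symmetric])
  then have "(\<Sum>y\<in>UNIV. (cmod (v $ y))\<^sup>2) = 0" using assms by (metis of_real_eq_0_iff)
  then show ?thesis by (simp add: sum_nonneg_eq_0_iff vec_eq_iff)
qed

lemma inner_eq_Re_hermitian_inner: "inner v w = Re (hermitian_inner v w)"
  by (simp add: inner_vec_def hermitian_inner_def inner_complex_def)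

text \<open>The real inner product is the real part of the hermitian one. As U is closed under
  multiplication by \<i>, real orthogonality to both w and \<i> w kills the imaginary part
  too.\<close>

lemma exists_orthogonal_proj:
  fixes U :: "(complex ^ 'x) set"
  assumes U: "vec.subspace U"
  shows "\<exists>u\<in>U. \<forall>w\<in>U. hermitian_inner (v - u) w = 0"
proof -
  have scaleR: "c *\<^sub>R w = complex_of_real c *s w" for c and w :: "complex ^ 'x"
    by (simp add: vec_eq_iff scaleR_conv_of_real[where 'a = complex])
  have sub: "subspace U"
    using U unfolding subspace_def vec.subspace_def scaleR by blast
  obtain u z where uz: "u \<in> U" "\<And>w. w \<in> U \<Longrightarrow> orthogonal z w" "v = u + z"
    using orthogonal_subspace_decomp_exists[of U v] span_eq_iff[THEN iffD2, OF sub] by metis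
  have "hermitian_inner z w = 0" if w: "w \<in> U" for w
  proof -
    have "\<i> *s w \<in> U" using U w by (rule vec.subspace_scale)
    then have "Re (hermitian_inner z (\<i> *s w)) = 0" "Re (hermitian_inner z w) = 0"
      using uz(2) w by (auto simp: orthogonal_def inner_eq_Re_hermitian_inner)
    then show ?thesis by (simp add: hermitian_inner_scale_right complex_eq_iff)
  qed
  then show ?thesis using uz by (intro bexI[of _ u]) auto
qed

text \<open>Two candidates for the projection differ by a vector of U orthogonal to itself, so the
  definite description is legitimate. Dual supports can then be read off from inner
  products.\<close>

lemma orthogonal_proj_eq_0_iff:
  fixes U :: "(complex ^ 'x) set"
  assumes U: "vec.subspace U"
  shows "orthogonal_proj U v = 0 \<longleftrightarrow> (\<forall>w\<in>U. hermitian_inner v w = 0)"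
proof -
  let ?P = "\<lambda>u. u \<in> U \<and> (\<forall>w\<in>U. hermitian_inner (v - u) w = 0)"
  have uniq: "u = u'" if "?P u" "?P u'" for u u'
  proof -
    have d: "u' - u \<in> U" using that U by (auto intro: vec.subspace_diff)
    have "hermitian_inner (v - u) (u' - u) = 0" "hermitian_inner (v - u') (u' - u) = 0"
      using that d by blast+
    then have "hermitian_inner ((v - u) - (v - u')) (u' - u) = 0"
      unfolding hermitian_inner_diff_left[of "v - u"] by simp
    then have "u' - u = 0" by (intro hermitian_inner_self_eq_0) simp
    then show ?thesis by simp
  qed
  obtain u where u: "?P u" using exists_orthogonal_proj[OF U] by blast
  have p: "orthogonal_proj U v = u"
    unfolding orthogonal_proj_def using u uniq by (intro the_equality) auto
  show ?thesis
  proof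
    assume "orthogonal_proj U v = 0"
    then show "\<forall>w\<in>U. hermitian_inner v w = 0" using p u by simp
  next
    assume "\<forall>w\<in>U. hermitian_inner v w = 0"
    then have "?P 0" using U by (simp add: vec.subspace_0)
    then show "orthogonal_proj U v = 0" using p u uniq by simp
  qed
qed

lemma hermitian_inner_adjoint:
  "hermitian_inner (B *v u) v = hermitian_inner u ((\<chi> y z. cnj (B $ z $ y)) *v v)"
proof -
  have "hermitian_inner (B *v u) v = (\<Sum>y\<in>UNIV. \<Sum>z\<in>UNIV. B $ y $ z * u $ z * cnj (v $ y))"
    by (simp add: hermitian_inner_def matrix_vector_nth sum_distrib_right)
  also have "\<dots> = (\<Sum>z\<in>UNIV. \<Sum>y\<in>UNIV. B $ y $ z * u $ z * cnj (v $ y))"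
    by (rule sum.swap)
  also have "\<dots> = hermitian_inner u ((\<chi> y z. cnj (B $ z $ y)) *v v)"
    by (simp add: hermitian_inner_def matrix_vector_nth sum_distrib_left mult_ac)
  finally show ?thesis .
qed

context finite_vector_space
begin

lemma low_degree_lincomb:
  assumes "low_degree D t f" "low_degree D t g"
  shows "low_degree D t (\<lambda>y. r * f y + s * g y)"
proof -
  let ?A = "{a. subspace a \<and> dim a \<le> t}"
  obtain c where c: "\<And>y. subspace y \<Longrightarrow> dim y = D \<Longrightarrow> f y = (\<Sum>a\<in>?A. of_bool (a \<subseteq> y) * c a)"
    using assms(1) unfolding low_degree_def by blast
  obtain d where d: "\<And>y. subspace y \<Longrightarrow> dim y = D \<Longrightarrow> g y = (\<Sum>a\<in>?A. of_bool (a \<subseteq> y) * d a)"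
    using assms(2) unfolding low_degree_def by blast
  have "r * f y + s * g y = (\<Sum>a\<in>?A. of_bool (a \<subseteq> y) * (r * c a + s * d a))"
    if "subspace y" "dim y = D" for y
    unfolding c[OF that] d[OF that] sum_distrib_left sum.distrib[symmetric]
    by (intro sum.cong refl) (simp add: algebra_simps)
  then show ?thesis unfolding low_degree_def by (intro exI allI impI) simp
qed

lemma low_degree_indicator:
  assumes "subspace a" "dim a \<le> t"
  shows "low_degree D t (\<lambda>y. of_bool (a \<subseteq> y))"
proof -
  have "of_bool (a \<subseteq> y) = (\<Sum>b | subspace b \<and> dim b \<le> t. of_bool (b \<subseteq> y) * (of_bool (b = a) :: real))" for y
  proof -
    have "(\<Sum>b | subspace b \<and> dim b \<le> t. of_bool (b \<subseteq> y) * (of_bool (b = a) :: real))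
        = (\<Sum>b | subspace b \<and> dim b \<le> t. if b = a then of_bool (a \<subseteq> y) else 0)"
      by (intro sum.cong refl) auto
    then show ?thesis using assms by simp
  qed
  then show ?thesis unfolding low_degree_def by (intro exI allI impI)
qed

lemma low_degree_cong:
  assumes "low_degree D t f" "\<And>y. subspace y \<Longrightarrow> dim y = D \<Longrightarrow> f y = g y"
  shows "low_degree D t g"
  using assms unfolding low_degree_def by auto

end

context grassmann
begin

text \<open>A complex scalar mixes real and imaginary parts, so both claims go through the span
  induction together.\<close>

lemma U_low_degree:
  assumes "v \<in> U (Suc t)"
  shows "low_degree D t (\<lambda>y. Re (v $ y))" "low_degree D t (\<lambda>y. Im (v $ y))"
proof -
  have "low_degree D t (\<lambda>y. Re (v $ y)) \<and> low_degree D t (\<lambda>y. Im (v $ y))"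
    using assms unfolding U_def
  proof (rule vec.span_induct)
    show "vec.subspace {v. low_degree D t (\<lambda>y. Re (v $ y)) \<and> low_degree D t (\<lambda>y. Im (v $ y))}"
    proof (rule vec.subspaceI)
      have z: "low_degree D t (\<lambda>y. 0)" unfolding low_degree_def by (rule exI[of _ "\<lambda>a. 0"]) simp
      then show "0 \<in> {v. low_degree D t (\<lambda>y. Re (v $ y)) \<and> low_degree D t (\<lambda>y. Im (v $ y))}" by simp
    next
      fix v w assume "v \<in> {v. low_degree D t (\<lambda>y. Re (v $ y)) \<and> low_degree D t (\<lambda>y. Im (v $ y))}"
        "w \<in> {v. low_degree D t (\<lambda>y. Re (v $ y)) \<and> low_degree D t (\<lambda>y. Im (v $ y))}"
      then show "v + w \<in> {v. low_degree D t (\<lambda>y. Re (v $ y)) \<and> low_degree D t (\<lambda>y. Im (v $ y))}"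
        using low_degree_lincomb[of D t "\<lambda>y. Re (v $ y)" "\<lambda>y. Re (w $ y)" 1 1]
          low_degree_lincomb[of D t "\<lambda>y. Im (v $ y)" "\<lambda>y. Im (w $ y)" 1 1] by simp
    next
      fix c v assume "v \<in> {v. low_degree D t (\<lambda>y. Re (v $ y)) \<and> low_degree D t (\<lambda>y. Im (v $ y))}"
      then show "c *s v \<in> {v. low_degree D t (\<lambda>y. Re (v $ y)) \<and> low_degree D t (\<lambda>y. Im (v $ y))}"
        using low_degree_lincomb[of D t "\<lambda>y. Re (v $ y)" "\<lambda>y. Im (v $ y)" "Re c" "- Im c"]
          low_degree_lincomb[of D t "\<lambda>y. Re (v $ y)" "\<lambda>y. Im (v $ y)" "Im c" "Re c"]
        by (simp add: algebra_simps)
    qed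
  next
    fix v assume "v \<in> {eta a | a. subspace a \<and> dim a < Suc t}"
    then obtain a where a: "v = eta a" "subspace a" "dim a \<le> t" by auto
    have "low_degree D t (\<lambda>y. Re (eta a $ y))"
      using low_degree_indicator[OF a(2,3)] by (rule low_degree_cong) (simp add: eta_nth X_iff)
    moreover have "low_degree D t (\<lambda>y. Im (eta a $ y))"
      using low_degree_lincomb[of D t _ _ 0 0, OF low_degree_indicator[OF a(2,3)] low_degree_indicator[OF a(2,3)]]
      by (rule low_degree_cong) (simp add: eta_nth)
    ultimately show "low_degree D t (\<lambda>y. Re (v $ y)) \<and> low_degree D t (\<lambda>y. Im (v $ y))"
      using a by simp
  qed
  then show "low_degree D t (\<lambda>y. Re (v $ y))" "low_degree D t (\<lambda>y. Im (v $ y))" by auto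
qed

lemma U_vanishing:
  assumes v: "v \<in> U (Suc t)" and zero: "\<And>y. y \<in> X \<Longrightarrow> dim (y \<inter> x) \<le> t \<Longrightarrow> v $ y = 0" and y: "y \<in> X"
  shows "v $ y = 0"
proof -
  have "Re (v $ y) = 0"
    by (rule low_degree_vanishing[OF U_low_degree(1)[OF v] x_subspace dim_x two_D_less])
      (use zero y in \<open>auto simp: X_iff\<close>)
  moreover have "Im (v $ y) = 0"
    by (rule low_degree_vanishing[OF U_low_degree(2)[OF v] x_subspace dim_x two_D_less])
      (use zero y in \<open>auto simp: X_iff\<close>)
  ultimately show ?thesis by (simp add: complex_eq_iff)
qed

section \<open>The module \<open>M\<close>\<close>

definition M :: "(complex ^ 'v set) set" where
  "M = {v \<in> V. \<forall>y\<in>X. \<forall>y'\<in>X. y \<inter> x = y' \<inter> x \<longrightarrow> v $ y = v $ y'}"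

lemma M_I:
  "v \<in> V \<Longrightarrow> (\<And>y y'. y \<in> X \<Longrightarrow> y' \<in> X \<Longrightarrow> y \<inter> x = y' \<inter> x \<Longrightarrow> v $ y = v $ y') \<Longrightarrow> v \<in> M"
  unfolding M_def by blast

lemma M_subset: "M \<subseteq> V"
  unfolding M_def by blast

lemma M_eq: "v \<in> M \<Longrightarrow> y \<in> X \<Longrightarrow> y' \<in> X \<Longrightarrow> y \<inter> x = y' \<inter> x \<Longrightarrow> v $ y = v $ y'"
  unfolding M_def by blast

lemma U_vanishing_in_M:
  assumes v: "v \<in> U (Suc t)" "v \<in> V"
    and zero: "\<And>y. y \<in> X \<Longrightarrow> dim (y \<inter> x) < t \<Longrightarrow> v $ y = 0"
  shows "v \<in> M"
proof -
  have "v $ y = v $ y'" if y: "y \<in> X" "y' \<in> X" "y \<inter> x = y' \<inter> x" for y y'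
  proof -
    have "Re (v $ y) = Re (v $ y')"
      by (rule low_degree_depends_on_intersection[OF U_low_degree(1)[OF v(1)] x_subspace dim_x two_D_less])
        (use zero y in \<open>auto simp: X_iff\<close>)
    moreover have "Im (v $ y) = Im (v $ y')"
      by (rule low_degree_depends_on_intersection[OF U_low_degree(2)[OF v(1)] x_subspace dim_x two_D_less])
        (use zero y in \<open>auto simp: X_iff\<close>)
    ultimately show ?thesis by (simp add: complex_eq_iff)
  qed
  then show ?thesis using v(2) by (intro M_I)
qed

lemma subspace_M: "vec.subspace M"
proof (rule vec.subspaceI)
  show "0 \<in> M" by (intro M_I) (simp_all add: standard_module_iff)
next
  fix v w assume vw: "v \<in> M" "w \<in> M"
  show "v + w \<in> M"
  proof (rule M_I)
    show "v + w \<in> V" using vw M_subset subspace_standard_module by (blast intro: vec.subspace_add)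
    fix y y' assume "y \<in> X" "y' \<in> X" "y \<inter> x = y' \<inter> x"
    then show "(v + w) $ y = (v + w) $ y'"
      unfolding vector_add_component by (intro arg_cong2[where f = "(+)"] M_eq vw)
  qed
next
  fix c v assume v: "v \<in> M"
  show "c *s v \<in> M"
  proof (rule M_I)
    show "c *s v \<in> V" using v M_subset subspace_standard_module by (blast intro: vec.subspace_scale)
    fix y y' assume "y \<in> X" "y' \<in> X" "y \<inter> x = y' \<inter> x"
    then show "(c *s v) $ y = (c *s v) $ y'"
      unfolding vector_smult_component by (intro arg_cong2[where f = "(*)"] refl M_eq v)
  qed
qed

lemma eta_in_M:
  assumes "a \<subseteq> x"
  shows "eta a \<in> M"
proof (rule M_I[OF eta_in_standard_module])
  fix y y' assume y: "y \<in> X" "y' \<in> X" "y \<inter> x = y' \<inter> x"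
  then have "a \<subseteq> y \<longleftrightarrow> a \<subseteq> y'" using assms by blast
  then show "eta a $ y = eta a $ y'" using y by (simp only: eta_nth)
qed

text \<open>Needed to see that \<open>M\<close> is closed under \<open>A\<close>. If v in
  \<open>M\<close> vanishes where dim (y \<inter> x) < k, subtract its values on level k times the
  \<open>eta a\<close> with dim a = k: at level k such an \<open>eta a\<close> is nonzero only where
  y \<inter> x = a, so the difference vanishes one level further.\<close>

lemma M_eq_span_eta: "M = vec.span {eta a | a. subspace a \<and> a \<subseteq> x}"
proof
  let ?S = "vec.span {eta a | a. subspace a \<and> a \<subseteq> x}"
  show "?S \<subseteq> M" using eta_in_M subspace_M by (intro vec.span_minimal) auto
  have "v \<in> ?S" if "v \<in> M" "\<And>y. y \<in> X \<Longrightarrow> dim (y \<inter> x) < k \<Longrightarrow> v $ y = 0" "k \<le> Suc D" for v k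
    using that(3,1,2)
  proof (induction k arbitrary: v rule: inc_induct)
    case base
    have "v $ y = 0" for y
    proof (cases "y \<in> X")
      case True
      then show ?thesis using base(2) dim_Int_x_le by (simp add: less_Suc_eq_le)
    next
      case False
      then show ?thesis using base(1) M_subset by (auto simp: standard_module_iff)
    qed
    then have "v = 0" by (simp add: vec_eq_iff)
    then show ?case by (simp add: vec.span_zero)
  next
    case (step k)
    let ?C = "\<lambda>u y. y \<in> X \<and> y \<inter> x = u"
    let ?A = "{a. subspace a \<and> a \<subseteq> x \<and> dim a = k}"
    define c where "c = (\<lambda>a. v $ (SOME y. ?C a y))"
    define w where "w = (\<Sum>a\<in>?A. c a *s eta a)"
    have w: "w \<in> ?S" unfolding w_def by (intro vec.span_sum vec.span_scale vec.span_base) auto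
    have "v - w \<in> ?S"
    proof (rule step.IH)
      have "w \<in> M" using w \<open>?S \<subseteq> M\<close> by blast
      then show "v - w \<in> M" using step.prems subspace_M by (simp add: vec.subspace_diff)
      fix y assume y: "y \<in> X" "dim (y \<inter> x) < Suc k"
      have yx: "subspace (y \<inter> x)" using y x_subspace by (simp add: X_iff subspace_inter)
      have "w $ y = (\<Sum>a\<in>?A. if a = y \<inter> x then c (y \<inter> x) else 0)"
        unfolding w_def sum_component
      proof (intro sum.cong refl)
        fix a assume a: "a \<in> ?A"
        have "a \<subseteq> y \<longleftrightarrow> a = y \<inter> x"
        proof
          assume "a \<subseteq> y"
          then show "a = y \<inter> x" using a y yx by (intro subspace_eqI) auto
        qed auto
        then show "(c a *s eta a) $ y = (if a = y \<inter> x then c (y \<inter> x) else 0)"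
          using y by (simp add: eta_nth)
      qed
      also have "\<dots> = v $ y"
      proof (cases "dim (y \<inter> x) = k")
        case True
        have "?C (y \<inter> x) (SOME z. ?C (y \<inter> x) z)" by (rule someI[of _ y]) (use y in auto)
        then have "v $ (SOME z. ?C (y \<inter> x) z) = v $ y"
          using step.prems(1) y by (intro M_eq[of v]) auto
        then show ?thesis using True yx by (simp add: c_def)
      next
        case False
        then have "v $ y = 0" using step.prems(2) y by simp
        moreover have "y \<inter> x \<notin> ?A" using False by simp
        ultimately show ?thesis by (simp del: mem_Collect_eq)
      qed
      finally show "(v - w) $ y = 0" by simp
    qed
    then have "v - w + w \<in> ?S" using w by (rule vec.span_add)
    then show ?case by simp
  qed
  from this[of _ 0] show "M \<subseteq> ?S" by auto
qed

text \<open>\<open>adjacency_eta\<close> involves only subspaces of \<open>a\<close>, which stay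
  inside \<open>x\<close>.\<close>

lemma M_adjacency_closed:
  assumes "v \<in> M"
  shows "A *v v \<in> M"
  using assms unfolding M_eq_span_eta
proof (rule vec.span_induct)
  let ?S = "vec.span {eta a | a. subspace a \<and> a \<subseteq> x}"
  show "vec.subspace {v. A *v v \<in> ?S}"
    by (auto simp: vec.subspace_def vec.add vec.scale intro: vec.span_zero vec.span_add vec.span_scale)
  fix v assume "v \<in> {eta a | a. subspace a \<and> a \<subseteq> x}"
  then obtain a where a: "v = eta a" "subspace a" "a \<subseteq> x" by auto
  have "dim a \<le> D" using dim_subset[OF a(3)] dim_x by simp
  then show "A *v v \<in> ?S"
    unfolding a(1) using a
    by (subst adjacency_eta, simp, simp, intro vec.span_add vec.span_scale vec.span_sum)
      (auto intro!: vec.span_base)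
qed

section \<open>Submodules and complete reducibility\<close>

abbreviation T :: "(complex ^ 'v set ^ 'v set) set" where "T \<equiv> terwilliger_algebra scale D x"
abbreviation Es :: "nat \<Rightarrow> complex ^ 'v set ^ 'v set" where "Es \<equiv> dual_idem scale D x"

lemma T_moduleI:
  assumes "vec.subspace W" "W \<subseteq> V" "\<And>w. w \<in> W \<Longrightarrow> A *v w \<in> W"
    and "\<And>i w. i \<le> D \<Longrightarrow> w \<in> W \<Longrightarrow> Es i *v w \<in> W"
  shows "T_module scale D x W"
  unfolding T_module_def
proof (intro conjI ballI)
  fix B w assume "B \<in> T" "w \<in> W"
  then show "B *v w \<in> W"
  proof (induction arbitrary: w rule: terwilliger_algebra.induct)
    case identity
    have "(\<chi> y z. if y = z \<and> y \<in> X then 1 else 0) *v w = w"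
    proof (rule vec_eq_iff[THEN iffD2], rule allI)
      fix y
      have "((\<chi> y z. if y = z \<and> y \<in> X then 1 else 0) *v w) $ y
          = (\<Sum>z\<in>UNIV. if z = y then (if y \<in> X then w $ y else 0) else 0)"
        unfolding matrix_vector_nth by (intro sum.cong refl) auto
      then show "((\<chi> y z. if y = z \<and> y \<in> X then 1 else 0) *v w) $ y = w $ y"
        using identity assms(2) by (auto simp: standard_module_iff)
    qed
    then show ?case using identity by simp
  next
    case (add B C)
    then show ?case using assms(1) by (simp add: matrix_vector_mult_add_rdistrib vec.subspace_add)
  next
    case (scalar B c)
    have "(\<chi> y z. c * B $ y $ z) *v w = c *s (B *v w)"
      by (simp add: vec_eq_iff matrix_vector_nth sum_distrib_left mult.assoc)
    then show ?case using scalar assms(1) by (simp add: vec.subspace_scale)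
  next
    case (mult B C)
    then show ?case by (simp flip: matrix_vector_mul_assoc)
  qed (use assms in auto)
qed (use assms in auto)

lemma T_moduleD:
  assumes "T_module scale D x W"
  shows "vec.subspace W" "W \<subseteq> V" "w \<in> W \<Longrightarrow> A *v w \<in> W" "i \<le> D \<Longrightarrow> w \<in> W \<Longrightarrow> Es i *v w \<in> W"
  using assms terwilliger_algebra.adjacency terwilliger_algebra.dual unfolding T_module_def by blast+

lemma adjacency_self_adjoint: "hermitian_inner (A *v v) w = hermitian_inner v (A *v w)"
proof -
  have "(\<chi> y z. cnj (A $ z $ y)) = A"
    by (simp add: vec_eq_iff adjacency_matrix_def E_sym)
  then show ?thesis by (simp add: hermitian_inner_adjoint)
qed

lemma dual_idem_self_adjoint: "hermitian_inner (Es i *v v) w = hermitian_inner v (Es i *v w)"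
proof -
  have "(\<chi> y z. cnj (Es i $ z $ y)) = Es i"
    by (auto simp: vec_eq_iff dual_idem_def)
  then show ?thesis by (simp add: hermitian_inner_adjoint)
qed

lemma T_module_M: "T_module scale D x M"
proof (rule T_moduleI[OF subspace_M])
  show "Es i *v w \<in> M" if w: "w \<in> M" for i w
  proof (rule M_I)
    show "Es i *v w \<in> V" by (simp add: standard_module_iff dual_idem_nth)
    fix y y' assume y: "y \<in> X" "y' \<in> X" "y \<inter> x = y' \<inter> x"
    then have "w $ y = w $ y'" by (rule M_eq[OF w])
    then show "(Es i *v w) $ y = (Es i *v w) $ y'" using y by (simp only: dual_idem_nth)
  qed
qed (use M_adjacency_closed M_subset in auto)

lemma T_module_orthogonal:
  assumes W: "T_module scale D x W" and W': "T_module scale D x W'"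
  shows "T_module scale D x {w \<in> W. \<forall>u\<in>W'. hermitian_inner w u = 0}"
proof (rule T_moduleI)
  show "vec.subspace {w \<in> W. \<forall>u\<in>W'. hermitian_inner w u = 0}"
    using T_moduleD(1)[OF W]
    by (simp add: vec.subspace_def hermitian_inner_add_left hermitian_inner_scale_left)
qed (use T_moduleD[OF W] T_moduleD[OF W'] adjacency_self_adjoint dual_idem_self_adjoint in auto)

lemma T_module_Int:
  assumes W: "T_module scale D x W" and W': "T_module scale D x W'"
  shows "T_module scale D x (W \<inter> W')"
  using T_moduleD[OF W] T_moduleD[OF W'] by (intro T_moduleI) (auto intro: vec.subspace_inter)

text \<open>The generators are self-adjoint, so the orthogonal complement of a submodule is again a
  submodule; split and induct on the dimension.\<close>

lemma completely_reducible:
  assumes "T_module scale D x W"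
  shows "W \<subseteq> vec.span (\<Union> {W'. irreducible_T_module scale D x W' \<and> W' \<subseteq> W})"
  using assms
proof (induction "vec.dim W" arbitrary: W rule: less_induct)
  case (less W)
  let ?S = "\<lambda>W. vec.span (\<Union> {W'. irreducible_T_module scale D x W' \<and> W' \<subseteq> W})"
  note W = T_moduleD[OF less.prems]
  have smaller: "vec.dim W' < vec.dim W" if "vec.subspace W'" "W' \<subseteq> W" "W' \<noteq> W" for W'
    using vec.subspace_dim_equal[OF that(1) W(1) that(2)] that(3) by (meson not_le)
  consider "W = {0}" | "irreducible_T_module scale D x W"
    | U where "T_module scale D x U" "U \<subseteq> W" "U \<noteq> {0}" "U \<noteq> W"
    using less.prems unfolding irreducible_T_module_def by blast
  then show ?case
  proof cases
    case 1
    then show ?thesis by (simp add: vec.span_zero)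
  next
    case 2
    then show ?thesis by (intro subset_trans[OF _ vec.span_superset]) blast
  next
    case 3
    let ?U' = "{w \<in> W. \<forall>u\<in>U. hermitian_inner w u = 0}"
    note U = T_moduleD[OF 3(1)]
    have U': "T_module scale D x ?U'" using less.prems 3(1) by (rule T_module_orthogonal)
    obtain u where u: "u \<in> U" "u \<noteq> 0" using 3(3) vec.subspace_0[OF U(1)] by blast
    have "u \<notin> ?U'" using u hermitian_inner_self_eq_0 by blast
    then have "?U' \<noteq> W" using u 3(2) by blast
    then have "?U' \<subseteq> ?S ?U'" using U' T_moduleD(1)[OF U'] by (intro less.hyps smaller) auto
    also have "\<dots> \<subseteq> ?S W" by (intro vec.span_mono Union_mono) auto
    finally have c: "?U' \<subseteq> ?S W" .
    have "U \<subseteq> ?S U" using 3 U(1) by (intro less.hyps smaller)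
    also have "\<dots> \<subseteq> ?S W" using 3(2) by (intro vec.span_mono Union_mono) auto
    finally have b: "U \<subseteq> ?S W" .
    show ?thesis
    proof
      fix w assume w: "w \<in> W"
      obtain p where p: "p \<in> U" "\<forall>u\<in>U. hermitian_inner (w - p) u = 0"
        using exists_orthogonal_proj[OF U(1)] by blast
      have "w - p \<in> ?U'" using p w 3(2) W(1) by (auto intro: vec.subspace_diff)
      then have "w - p + p \<in> ?S W" using b c p by (intro vec.span_add) auto
      then show "w \<in> ?S W" by simp
    qed
  qed
qed

end

section \<open>The nucleus\<close>

context grassmann
begin

section \<open>Support and dual support of a module\<close>

lemma support_iff:
  "i \<in> support scale D x W \<longleftrightarrow> i \<le> D \<and> (\<exists>w\<in>W. \<exists>y\<in>X. D - dim (y \<inter> x) = i \<and> w $ y \<noteq> 0)"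
proof -
  have "Es i *v w \<noteq> 0 \<longleftrightarrow> (\<exists>y\<in>X. D - dim (y \<inter> x) = i \<and> w $ y \<noteq> 0)" for w
    by (auto simp: vec_eq_iff dual_idem_nth)
  then show ?thesis by (simp add: support_def)
qed

lemma in_supportI:
  assumes "w \<in> W" "y \<in> X" "w $ y \<noteq> 0"
  shows "D - dim (y \<inter> x) \<in> support scale D x W"
  using assms by (auto simp: support_iff)

lemma finite_support: "finite (support scale D x W)"
  by (rule finite_subset[of _ "{..D}"]) (auto simp: support_def)

lemma dual_support_iff:
  "i \<in> dual_support scale D W \<longleftrightarrow> i \<le> D \<and> (\<exists>w\<in>W. \<exists>e\<in>Eig i. hermitian_inner w e \<noteq> 0)"
  by (simp add: dual_support_def primitive_idem_def orthogonal_proj_eq_0_iff[OF subspace_Eig])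

lemma finite_dual_support: "finite (dual_support scale D W)"
  by (rule finite_subset[of _ "{..D}"]) (auto simp: dual_support_def)

lemma Eig_orthogonal:
  assumes "e \<in> Eig i" "e' \<in> Eig j" "i \<noteq> j" "i \<le> D" "j \<le> D"
  shows "hermitian_inner e e' = 0"
proof -
  have "of_real (\<theta> i) * hermitian_inner e e' = hermitian_inner (A *v e) e'"
    using assms(1) by (simp add: Eig_iff hermitian_inner_scale_left)
  also have "\<dots> = hermitian_inner e (A *v e')" by (rule adjacency_self_adjoint)
  also have "\<dots> = of_real (\<theta> j) * hermitian_inner e e'"
    using assms(2) by (simp add: Eig_iff hermitian_inner_scale_right)
  finally show ?thesis using theta_inject[OF assms(4,5)] assms(3) by simp
qed

lemma standard_module_eigen_decomposition:
  assumes "v \<in> V"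
  shows "\<exists>e. (\<forall>j\<le>D. e j \<in> Eig j) \<and> v = (\<Sum>j\<le>D. e j)"
proof -
  let ?R = "\<lambda>v. \<exists>e. (\<forall>j\<le>D. e j \<in> Eig j) \<and> v = (\<Sum>j\<le>D. e j)"
  have "v \<in> vec.span (\<Union>j\<le>D. Eig j)" using assms standard_module_subset_span_Eig by blast
  then show ?thesis
  proof (rule vec.span_induct)
    show "vec.subspace {v. ?R v}"
    proof (rule vec.subspaceI)
      show "0 \<in> {v. ?R v}"
        by (intro CollectI exI[of _ "\<lambda>_. 0"]) (simp add: vec.subspace_0[OF subspace_Eig])
    next
      fix v w assume "v \<in> {v. ?R v}" "w \<in> {v. ?R v}"
      then obtain e e' where "\<forall>j\<le>D. e j \<in> Eig j" "v = (\<Sum>j\<le>D. e j)"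
        "\<forall>j\<le>D. e' j \<in> Eig j" "w = (\<Sum>j\<le>D. e' j)" by auto
      then show "v + w \<in> {v. ?R v}"
        by (intro CollectI exI[of _ "\<lambda>j. e j + e' j"])
          (simp add: vec.subspace_add[OF subspace_Eig] sum.distrib)
    next
      fix c v assume "v \<in> {v. ?R v}"
      then obtain e where "\<forall>j\<le>D. e j \<in> Eig j" "v = (\<Sum>j\<le>D. e j)" by auto
      then show "c *s v \<in> {v. ?R v}"
        by (intro CollectI exI[of _ "\<lambda>j. c *s e j"])
          (simp add: vec.subspace_scale[OF subspace_Eig] vec.scale_sum_right)
    qed
    fix v assume "v \<in> (\<Union>j\<le>D. Eig j)"
    then obtain i where "i \<le> D" "v \<in> Eig i" by blast
    then show "?R v"
      by (intro exI[of _ "\<lambda>j. if j = i then v else 0"]) (simp add: vec.subspace_0[OF subspace_Eig])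
  qed
qed

text \<open>Applying A - \<theta> k removes the component at k and scales the others by nonzero
  numbers, since the eigenvalues are distinct.\<close>

lemma eigen_components_in_invariant:
  assumes W: "vec.subspace W" "\<And>w. w \<in> W \<Longrightarrow> A *v w \<in> W"
    and "finite J" "J \<subseteq> {..D}" "\<And>j. j \<in> J \<Longrightarrow> e j \<in> Eig j" "(\<Sum>j\<in>J. e j) \<in> W"
  shows "\<forall>j\<in>J. e j \<in> W"
  using assms(3-6)
proof (induction J arbitrary: e rule: finite_induct)
  case (insert k J)
  let ?w = "\<Sum>j\<in>insert k J. e j"
  let ?c = "\<lambda>j. complex_of_real (\<theta> j) - of_real (\<theta> k)"
  have ek: "A *v e k = of_real (\<theta> k) *s e k" using insert.prems by (simp add: Eig_iff)
  have "A *v ?w - of_real (\<theta> k) *s ?w = (\<Sum>j\<in>J. A *v e j - of_real (\<theta> k) *s e j)"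
    using insert.hyps ek
    by (simp add: vec.add vec.sum vec.scale_right_distrib vec.scale_sum_right sum_subtractf)
  also have "\<dots> = (\<Sum>j\<in>J. ?c j *s e j)"
    using insert.prems by (intro sum.cong refl) (simp add: Eig_iff vec.scale_left_diff_distrib)
  finally have eq: "A *v ?w - of_real (\<theta> k) *s ?w = (\<Sum>j\<in>J. ?c j *s e j)" .
  have "A *v ?w - of_real (\<theta> k) *s ?w \<in> W"
    using insert.prems W by (intro vec.subspace_diff vec.subspace_scale) auto
  then have sW: "\<forall>j\<in>J. ?c j *s e j \<in> W"
    unfolding eq using insert.prems
    by (intro insert.IH vec.subspace_scale[OF subspace_Eig]) auto
  have J: "e j \<in> W" if j: "j \<in> J" for j
  proof -
    have "j \<noteq> k" "j \<le> D" "k \<le> D" using j insert by auto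
    then have "?c j \<noteq> 0" using theta_inject by simp
    then have "inverse (?c j) * ?c j = 1" by simp
    then have "inverse (?c j) *s (?c j *s e j) = e j" by (simp only: vec.scale_scale vec.scale_one)
    moreover have "inverse (?c j) *s (?c j *s e j) \<in> W"
      by (rule vec.subspace_scale[OF W(1) bspec[OF sW j]])
    ultimately show ?thesis by metis
  qed
  then have "(\<Sum>j\<in>J. e j) \<in> W" by (intro vec.subspace_sum W(1))
  then have "?w - (\<Sum>j\<in>J. e j) \<in> W" by (rule vec.subspace_diff[OF W(1) insert.prems(3)])
  then have "e k \<in> W" using insert.hyps by simp
  then show ?case using J by simp
qed simp

text \<open>By orthogonality of the eigenspaces, w pairs with a vector of \<open>Eig t\<close> only
  through its own component there, which is therefore nonzero and lies in \<open>W\<close>.\<close>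

lemma dual_support_eigenvector:
  assumes W: "T_module scale D x W" and t: "t \<in> dual_support scale D W"
  shows "\<exists>f\<in>W. f \<in> Eig t \<and> f \<noteq> 0"
proof -
  obtain w e0 where w: "w \<in> W" "e0 \<in> Eig t" "hermitian_inner w e0 \<noteq> 0" and tD: "t \<le> D"
    using t by (auto simp: dual_support_iff)
  have "w \<in> V" using w T_moduleD(2)[OF W] by blast
  then obtain e where e: "\<forall>j\<le>D. e j \<in> Eig j" "w = (\<Sum>j\<le>D. e j)"
    using standard_module_eigen_decomposition by blast
  have "\<forall>j\<in>{..D}. e j \<in> W"
    using e w T_moduleD[OF W] by (intro eigen_components_in_invariant) auto
  moreover have "e t \<noteq> 0"
  proof
    assume et: "e t = 0"
    have "hermitian_inner (e j) e0 = 0" if "j \<le> D" for j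
      using et e Eig_orthogonal[of "e j" j e0 t] w tD that by (cases "j = t") auto
    moreover have "hermitian_inner (\<Sum>j\<in>J. e j) e0 = (\<Sum>j\<in>J. hermitian_inner (e j) e0)"
      if "finite J" for J using that
      by (induction J rule: finite_induct) (auto simp: hermitian_inner_add_left)
    ultimately show False using w(3) e(2) by simp
  qed
  ultimately show ?thesis using e tD by blast
qed

text \<open>\<open>A\<close> changes the distance from \<open>x\<close> by at most one. If distance
  i were missing, the members of \<open>W\<close> supported at distances below i would form a
  submodule, nonzero because of i1 and proper because of i2.\<close>

lemma support_no_gap:
  assumes W: "irreducible_T_module scale D x W"
    and i1: "i1 \<in> support scale D x W" and i2: "i2 \<in> support scale D x W" and i: "i1 < i" "i < i2"
  shows "i \<in> support scale D x W"
proof (rule ccontr)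
  assume gap: "i \<notin> support scale D x W"
  have TW: "T_module scale D x W" using W by (simp add: irreducible_T_module_def)
  note TW' = T_moduleD[OF TW]
  let ?W = "{w \<in> W. \<forall>y\<in>X. i \<le> D - dim (y \<inter> x) \<longrightarrow> w $ y = 0}"
  have "T_module scale D x ?W"
  proof (rule T_moduleI)
    show "vec.subspace ?W" using TW'(1) by (simp add: vec.subspace_def)
    show "?W \<subseteq> V" using TW'(2) by blast
  next
    fix w assume w: "w \<in> ?W"
    have "(A *v w) $ y = 0" if y: "y \<in> X" "i \<le> D - dim (y \<inter> x)" for y
    proof (cases "i = D - dim (y \<inter> x)")
      case True
      then show ?thesis using in_supportI[of "A *v w" W y] gap y w TW'(3) by blast
    next
      case False
      show ?thesis unfolding matrix_vector_nth
      proof (rule sum.neutral, rule ballI)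
        fix z
        show "A $ y $ z * w $ z = 0"
        proof (cases "(y, z) \<in> E")
          case True
          then have "(z, y) \<in> E" "z \<in> X" using E_sym by (auto simp: E_iff)
          then have "i \<le> D - dim (z \<inter> x)" using adjacent_dim_Int[of z y] False y by linarith
          then show ?thesis using w \<open>z \<in> X\<close> by simp
        qed (simp add: adjacency_matrix_def)
      qed
    qed
    then show "A *v w \<in> ?W" using w TW'(3) by simp
  next
    fix j w assume "j \<le> D" "w \<in> ?W"
    then show "Es j *v w \<in> ?W" using TW'(4) by (auto simp: dual_idem_nth)
  qed
  moreover have "?W \<noteq> {0}"
  proof -
    obtain w y where wy: "w \<in> W" "y \<in> X" "D - dim (y \<inter> x) = i1" "w $ y \<noteq> 0" "i1 \<le> D"
      using i1 by (auto simp: support_iff)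
    have "Es i1 *v w \<in> ?W" using TW'(4) wy i by (auto simp: dual_idem_nth)
    moreover have "(Es i1 *v w) $ y \<noteq> 0" using wy by (simp add: dual_idem_nth)
    ultimately show ?thesis by (metis singletonD zero_index)
  qed
  moreover have "?W \<noteq> W"
  proof -
    obtain w y where "w \<in> W" "y \<in> X" "D - dim (y \<inter> x) = i2" "w $ y \<noteq> 0"
      using i2 by (auto simp: support_iff)
    then have "w \<notin> ?W" using i less_imp_le by blast
    then show ?thesis using \<open>w \<in> W\<close> by blast
  qed
  ultimately show False using W unfolding irreducible_T_module_def by blast
qed

lemma support_nonempty:
  assumes "T_module scale D x W" "W \<noteq> {0}"
  shows "support scale D x W \<noteq> {}"
proof -
  obtain w where w: "w \<in> W" "w \<noteq> 0" using assms vec.subspace_0[OF T_moduleD(1)] by blast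
  then obtain y where "w $ y \<noteq> 0" by (auto simp: vec_eq_iff)
  moreover from this have "y \<in> X" using w T_moduleD(2)[OF assms(1)] standard_module_iff[of w] by blast
  ultimately show ?thesis using in_supportI w by blast
qed

lemma dual_support_nonempty:
  assumes "T_module scale D x W" "W \<noteq> {0}"
  shows "dual_support scale D W \<noteq> {}"
proof
  assume empty: "dual_support scale D W = {}"
  obtain w where w: "w \<in> W" "w \<noteq> 0" using assms vec.subspace_0[OF T_moduleD(1)] by blast
  have "hermitian_inner w v = 0" if "v \<in> vec.span (\<Union>j\<le>D. Eig j)" for v
    using that
  proof (rule vec.span_induct)
    show "vec.subspace {v. hermitian_inner w v = 0}"
      by (simp add: vec.subspace_def hermitian_inner_add_right hermitian_inner_scale_right)
    show "hermitian_inner w v = 0" if "v \<in> (\<Union>j\<le>D. Eig j)" for v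
      using that empty w dual_support_iff by blast
  qed
  moreover have "w \<in> vec.span (\<Union>j\<le>D. Eig j)"
    using w T_moduleD(2)[OF assms(1)] standard_module_subset_span_Eig by blast
  ultimately show False using w hermitian_inner_self_eq_0 by blast
qed

text \<open>The support is an interval, so the endpoint plus the diameter is its maximum.\<close>

lemma displacement_eq:
  assumes W: "irreducible_T_module scale D x W"
  shows "displacement scale D x W
    = int (Min (dual_support scale D W)) + int (Max (support scale D x W)) - int D"
proof -
  let ?S = "support scale D x W"
  have ne: "?S \<noteq> {}" using W support_nonempty by (simp add: irreducible_T_module_def)
  have MM: "Min ?S \<in> ?S" "Max ?S \<in> ?S" "Min ?S \<le> Max ?S"
    using ne finite_support by auto
  have "?S = {Min ?S..Max ?S}"
  proof (intro equalityI subsetI)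
    fix i assume i: "i \<in> {Min ?S..Max ?S}"
    show "i \<in> ?S"
    proof (cases "i = Min ?S \<or> i = Max ?S")
      case True
      then show ?thesis using MM by auto
    next
      case False
      then show ?thesis using i support_no_gap[OF W MM(1,2)] by simp
    qed
  qed (use finite_support in auto)
  then have "card ?S = Suc (Max ?S) - Min ?S" by (metis card_atLeastAtMost)
  then show ?thesis using MM(3)
    by (simp add: displacement_def module_diameter_def endpoint_def dual_endpoint_def)
qed

section \<open>Displacement zero and containment in \<open>M\<close>\<close>

lemma vanishing_beyond_support:
  assumes "w \<in> W" "y \<in> X" "dim (y \<inter> x) < D - Max (support scale D x W)"
  shows "w $ y = 0"
proof (rule ccontr)
  assume "w $ y \<noteq> 0"
  then have "D - dim (y \<inter> x) \<in> support scale D x W" using assms in_supportI by blast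
  then have "D - dim (y \<inter> x) \<le> Max (support scale D x W)" using finite_support by simp
  then show False using assms(3) by simp
qed

lemma zero_displacement_subset_M:
  assumes W: "irreducible_T_module scale D x W" and disp: "displacement scale D x W = 0"
  shows "W \<subseteq> M"
proof -
  have TW: "T_module scale D x W" "W \<noteq> {0}" using W by (auto simp: irreducible_T_module_def)
  define t where "t = Min (dual_support scale D W)"
  have t: "t \<in> dual_support scale D W"
    unfolding t_def using dual_support_nonempty[OF TW] finite_dual_support by simp
  then have tD: "t \<le> D" by (simp add: dual_support_iff)
  obtain f where f: "f \<in> W" "f \<in> Eig t" "f \<noteq> 0" using dual_support_eigenvector[OF TW(1) t] by blast
  have tm: "t = D - Max (support scale D x W)"
    using displacement_eq[OF W] disp tD unfolding t_def by linarith
  have "f \<in> M"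
  proof (rule U_vanishing_in_M)
    show "f \<in> U (Suc t)" "f \<in> V" using f Eig_subset_U[OF tD] by (auto simp: Eig_iff)
    show "f $ y = 0" if "y \<in> X" "dim (y \<inter> x) < t" for y
      using vanishing_beyond_support[OF f(1)] that tm by simp
  qed
  \<comment> \<open>Irreducibility spreads membership in \<open>M\<close> from the single vector f
    to all of \<open>W\<close>.\<close>
  then have "W \<inter> M \<noteq> {0}" using f by blast
  moreover have "T_module scale D x (W \<inter> M)" using TW(1) T_module_M by (rule T_module_Int)
  ultimately show ?thesis using W unfolding irreducible_T_module_def by blast
qed

text \<open>With m = D - s, \<open>U_vanishing\<close> excludes t < m. For t \<le> m, a member of
  \<open>W\<close> living at distance s pairs nontrivially with \<open>eta a\<close> for some a of
  dimension m, and \<open>eta a\<close> lies in the span of the eigenspaces with index at most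
  m.\<close>

lemma zero_displacement_of_subset_M:
  assumes W: "irreducible_T_module scale D x W" and WM: "W \<subseteq> M"
  shows "displacement scale D x W = 0"
proof -
  have TW: "T_module scale D x W" "W \<noteq> {0}" using W by (auto simp: irreducible_T_module_def)
  define t where "t = Min (dual_support scale D W)"
  define s where "s = Max (support scale D x W)"
  have t: "t \<in> dual_support scale D W"
    unfolding t_def using dual_support_nonempty[OF TW] finite_dual_support by simp
  then have tD: "t \<le> D" by (simp add: dual_support_iff)
  have "s \<in> support scale D x W"
    unfolding s_def using support_nonempty[OF TW] finite_support by simp
  then obtain w y where wy: "w \<in> W" "y \<in> X" "D - dim (y \<inter> x) = s" "w $ y \<noteq> 0" and sD: "s \<le> D"
    by (auto simp: support_iff)
  have "\<not> t < D - s"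
  proof
    assume ts: "t < D - s"
    obtain f where f: "f \<in> W" "f \<in> Eig t" "f \<noteq> 0" using dual_support_eigenvector[OF TW(1) t] by blast
    have "f $ y = 0" if "y \<in> X" for y
    proof (rule U_vanishing[OF _ _ that])
      show "f \<in> U (Suc t)" using f Eig_subset_U[OF tD] by blast
      show "f $ z = 0" if "z \<in> X" "dim (z \<inter> x) \<le> t" for z
        using vanishing_beyond_support[OF f(1)] that ts unfolding s_def by simp
    qed
    moreover have "f $ y = 0" if "y \<notin> X" for y
      using that f by (simp add: Eig_iff standard_module_iff)
    ultimately show False using f(3) by (metis vec_eq_iff zero_index)
  qed
  moreover have "t \<le> D - s"
  proof -
    let ?a = "y \<inter> x" and ?w = "Es s *v w"
    have a: "subspace ?a" using wy(2) x_subspace by (simp add: X_iff subspace_inter)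
    have da: "dim ?a = D - s" using wy(3) dim_Int_x_le[OF wy(2)] by simp
    \<comment> \<open>At distance s, containing \<open>?a\<close> forces z \<inter> x =
      \<open>?a\<close> by dimension, and there \<open>w\<close> is constant because it lies in
      \<open>M\<close>. The inner product is thus a positive multiple of
      \<open>w $ y\<close>.\<close>
    have "?w $ z * cnj (eta ?a $ z) = (if z \<in> X \<and> z \<inter> x = ?a then w $ y else 0)" for z
    proof (cases "z \<in> X \<and> ?a \<subseteq> z \<and> D - dim (z \<inter> x) = s")
      case True
      then have "dim (z \<inter> x) \<le> dim ?a" using da dim_Int_x_le[of z] by auto
      then have "?a = z \<inter> x"
        using True a x_subspace by (intro subspace_eqI) (auto simp: X_iff subspace_inter)
      moreover from this have "w $ z = w $ y" using True wy(1,2) WM by (intro M_eq[of w]) auto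
      ultimately show ?thesis using True by (simp add: dual_idem_nth eta_nth)
    next
      case False
      then have "\<not> (z \<in> X \<and> z \<inter> x = ?a)" using wy(3) by auto
      then show ?thesis using False by (auto simp: dual_idem_nth eta_nth)
    qed
    then have "hermitian_inner ?w (eta ?a) = of_nat (card {z. z \<in> X \<and> z \<inter> x = ?a}) * w $ y"
      by (simp add: hermitian_inner_def flip: sum.inter_filter)
    moreover have "card {z. z \<in> X \<and> z \<inter> x = ?a} \<noteq> 0" using wy(2) by auto
    ultimately have nz: "hermitian_inner ?w (eta ?a) \<noteq> 0" using wy(4) by simp
    have "\<exists>j\<le>D - s. \<exists>e\<in>Eig j. hermitian_inner ?w e \<noteq> 0"
    proof (rule ccontr)
      assume none: "\<not> (\<exists>j\<le>D - s. \<exists>e\<in>Eig j. hermitian_inner ?w e \<noteq> 0)"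
      have "eta ?a \<in> vec.span (\<Union>j\<le>D - s. Eig j)"
        using eta_in_span_Eig[OF a] da by simp
      then have "hermitian_inner ?w (eta ?a) = 0"
      proof (rule vec.span_induct)
        show "vec.subspace {v. hermitian_inner ?w v = 0}"
          by (simp add: vec.subspace_def hermitian_inner_add_right hermitian_inner_scale_right)
        show "hermitian_inner ?w v = 0" if "v \<in> (\<Union>j\<le>D - s. Eig j)" for v
          using that none by blast
      qed
      then show False using nz by contradiction
    qed
    then obtain j e where j: "j \<le> D - s" "e \<in> Eig j" "hermitian_inner ?w e \<noteq> 0" by blast
    have "?w \<in> W" using T_moduleD(4)[OF TW(1) sD wy(1)] .
    then have "j \<in> dual_support scale D W" using j by (auto simp: dual_support_iff)
    then have "t \<le> j" unfolding t_def using finite_dual_support by simp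
    then show ?thesis using j by simp
  qed
  ultimately have "t = D - s" by simp
  then show ?thesis using displacement_eq[OF W] sD unfolding t_def[symmetric] s_def[symmetric] by simp
qed

lemma nucleus_eq_M: "nucleus scale D x = M"
proof
  show "nucleus scale D x \<subseteq> M"
    unfolding nucleus_def using zero_displacement_subset_M subspace_M by (intro vec.span_minimal) auto
  have "M \<subseteq> vec.span (\<Union> {W. irreducible_T_module scale D x W \<and> W \<subseteq> M})"
    using T_module_M by (rule completely_reducible)
  also have "\<dots> \<subseteq> nucleus scale D x"
    unfolding nucleus_def using zero_displacement_of_subset_M by (intro vec.span_mono) blast
  finally show "M \<subseteq> nucleus scale D x" .
qed

section \<open>The dimension of \<open>M\<close>\<close>

lemma exists_vertex_with_intersection:
  assumes u: "subspace u" "u \<subseteq> x"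
  shows "\<exists>y\<in>X. y \<inter> x = u"
proof -
  obtain H where H: "subspace H" "u \<subseteq> H" "H \<inter> x = u" "dim H + D = N + dim u"
    using exists_transversal_extension[OF u(1) x_subspace] u dim_x by (auto simp: Int_absorb2)
  have "dim u \<le> D" using dim_subset[OF u(2)] dim_x by simp
  moreover have "D \<le> dim H" using H(4) two_D_less by simp
  ultimately obtain y where "subspace y" "u \<subseteq> y" "y \<subseteq> H" "dim y = D"
    using exists_between[OF u(1) H(1,2)] by blast
  then show ?thesis using H(3) u(2) by (intro bexI[of _ y]) (auto simp: X_iff)
qed

text \<open>The indicators of the classes y \<inter> x = u form a basis. Every class is nonempty,
  and evaluation at a representative \<open>Y u\<close> reads off the coordinate at u.\<close>

lemma dim_M: "vec.dim M = card {u. subspace u \<and> u \<subseteq> x}"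
proof -
  let ?S = "{u. subspace u \<and> u \<subseteq> x}"
  define b :: "'v set \<Rightarrow> complex ^ 'v set" where "b u = (\<chi> y. of_bool (y \<in> X \<and> y \<inter> x = u))" for u
  have b_nth: "b u $ y = of_bool (y \<in> X \<and> y \<inter> x = u)" for u y by (simp add: b_def)
  obtain Y where Y: "\<And>u. u \<in> ?S \<Longrightarrow> Y u \<in> X \<and> Y u \<inter> x = u"
    using exists_vertex_with_intersection by (metis mem_Collect_eq)
  have bY: "b u $ Y u' = of_bool (u = u')" if "u' \<in> ?S" for u u'
    using Y[OF that] by (auto simp: b_nth)
  have inj: "inj_on b ?S"
  proof (rule inj_onI)
    fix u u' assume u: "u \<in> ?S" "u' \<in> ?S" "b u = b u'"
    then have "b u $ Y u = b u' $ Y u" by simp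
    then show "u = u'" using bY[OF u(1)] by (auto split: if_splits)
  qed
  have bM: "b u \<in> M" for u
    by (rule M_I) (auto simp: standard_module_iff b_nth)
  have "v \<in> vec.span (b ` ?S)" if v: "v \<in> M" for v
  proof -
    have "v = (\<Sum>u\<in>?S. v $ Y u *s b u)"
    proof (rule vec_eq_iff[THEN iffD2], rule allI)
      fix y
      show "v $ y = (\<Sum>u\<in>?S. v $ Y u *s b u) $ y"
      proof (cases "y \<in> X")
        case True
        have yx: "y \<inter> x \<in> ?S" using True x_subspace by (simp add: X_iff subspace_inter)
        have "(\<Sum>u\<in>?S. v $ Y u *s b u) $ y = (\<Sum>u\<in>?S. if u = y \<inter> x then v $ Y (y \<inter> x) else 0)"
          unfolding sum_component using True by (intro sum.cong refl) (auto simp: b_nth)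
        also have "\<dots> = v $ Y (y \<inter> x)" using yx by simp
        also have "\<dots> = v $ y" using Y[OF yx] True by (intro M_eq[OF v]) auto
        finally show ?thesis by simp
      next
        case False
        then show ?thesis using v M_subset by (auto simp: sum_component b_nth standard_module_iff)
      qed
    qed
    moreover have "(\<Sum>u\<in>?S. v $ Y u *s b u) \<in> vec.span (b ` ?S)"
      by (intro vec.span_sum vec.span_scale vec.span_base) auto
    ultimately show ?thesis by simp
  qed
  moreover have "vec.independent (b ` ?S)"
  proof
    assume "vec.dependent (b ` ?S)"
    then obtain c v where c: "v \<in> b ` ?S" "c v \<noteq> 0" "(\<Sum>v\<in>b ` ?S. c v *s v) = 0"
      using vec.dependent_finite[of "b ` ?S"] by auto
    obtain u where u: "u \<in> ?S" "v = b u" using c(1) by blast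
    have "0 = (\<Sum>u\<in>?S. c (b u) *s b u) $ Y u"
      using c(3) by (simp add: sum.reindex[OF inj])
    also have "\<dots> = (\<Sum>u'\<in>?S. if u' = u then c (b u) else 0)"
      unfolding sum_component using bY[OF u(1)] by (intro sum.cong refl) auto
    also have "\<dots> = c (b u)" using u by simp
    finally show False using c(2) u by simp
  qed
  moreover have "b ` ?S \<subseteq> M" using bM by blast
  ultimately have "card (b ` ?S) = vec.dim M" by (intro vec.basis_card_eq_dim) auto
  then show ?thesis using card_image[OF inj] by simp
qed

lemma card_subspaces_of_x: "real (card {u. subspace u \<and> u \<subseteq> x}) = (\<Sum>i=0..D. qbinom q D i)"
proof -
  have "{u. subspace u \<and> u \<subseteq> x} = (\<Union>i\<in>{0..D}. between {0} x i)"
    using dim_subset[of _ x] dim_x subspace_0 by (auto simp: between_def)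
  also have "card \<dots> = (\<Sum>i=0..D. card (between {0} x i))"
    by (rule card_UN_disjoint) (auto simp: between_def)
  finally have "real (card {u. subspace u \<and> u \<subseteq> x}) = (\<Sum>i=0..D. real (card (between {0} x i)))"
    by simp
  also have "\<dots> = (\<Sum>i=0..D. qbinom q D i)"
    using card_between[of "{0}" x] x_subspace dim_x subspace_0[OF x_subspace]
    by (intro sum.cong refl) simp
  finally show ?thesis .
qed

end

theorem theorem6p10:
  fixes scale :: "'a::{field,finite} \<Rightarrow> 'v::{ab_group_add,finite} \<Rightarrow> 'v"
    and q N D :: nat and x :: "'v set"
  assumes "vector_space scale"
    and "CARD('a) = q"
    and "vector_space.dim scale (UNIV :: 'v set) = N"
    and "D \<ge> 1" and "N > 2 * D"
    and "x \<in> grassmann_vertices scale D"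
  shows "real (vec.dim (nucleus scale D x)) = (\<Sum>i=0..D. qbinom (real q) D i)"
proof -
  interpret grassmann scale "real q" D x
    using assms by (simp add: grassmann_def grassmann_axioms_def finite_vector_space_def
        finite_vector_space_axioms_def)
  show ?thesis by (simp only: nucleus_eq_M dim_M card_subspaces_of_x)
qed

end
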